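(* Let $\alpha>2$, $\theta>0$, $\sigma^2>0$, $0<\epsilon<1$ and an integer $K\ge 0$ be fixed. For $\lambda_b>0$ let $\Phi(\lambda_b)$ be the base-station process of density $\lambda_b$ (with a typical base station $Y_0$ at the origin), with active mobiles $U_Y$, $U_0=U_{Y_0}$, and set $\mathcal{C}$ of base stations whose mobiles' interference is canceled, as described in the context. Let $\mu>0$ be such that $$\Pr\left(\sum_{Y\in \Phi(1)} \left[|U_Y|^{-\alpha}\, 1\{Y \notin \{Y_0\}\cup\mathcal{C}\}-\theta^{-1} |U_0|^{-\alpha}\,1\{Y = Y_0\}\right]+ \mu > 0\right)=\epsilon .$$ Let $\mathcal{F}_c$ be the set of all pairs $(\lambda_b,p)$ of base-station density and mobile-transmission power for which the outage constraint $P_{\mathsf{out}}(\lambda_b,p)\le\epsilon$ holds. Then $$\mathcal{F}_c = \left\{(\lambda_b, p) \in \mathbb{R}_+^2 \;\middle|\; p\, \lambda_b^{\alpha/2} \geq \frac{\sigma^2}{\mu}\right\}.$$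
   Context: $\mathbb{R}_+$ is the set of nonnegative reals; the density $\lambda_b$ and power $p$ of an actual network are positive (the set on the right-hand side contains only positive pairs). Cellular (uplink) network model: base stations form a homogeneous Poisson point process on $\mathbb{R}^2$ with density $\lambda_b$. Considered from a typical base station $Y_0$ located at the origin (Palm version), the process $\Phi=\Phi(\lambda_b)$ consists of the point $Y_0=0$ together with a homogeneous Poisson point process of density $\lambda_b$ on $\mathbb{R}^2$. The Voronoi cells of the points of $\Phi$ partition the plane. Each base station $Y\in\Phi$ serves exactly one active mobile $U_Y$; given $\Phi$, the mobiles $U_Y$ are independent and $U_Y$ is uniformly distributed in the Voronoi cell of $Y$. Write $U_0=U_{Y_0}$. Let $K\ge 0$ be a fixed integer and let $\mathcal{C}\subset\Phi\setminus\{Y_0\}$ be the set of the $K$ base stations whose active mobiles are the $K$ interfering mobiles ($U_Y$ with $Y\ne Y_0$) nearest to $Y_0$; their interference at $Y_0$ is perfectly canceled. All mobiles transmit with power $p$, a signal sent with power $a$ by a mobile $U$ is received at a base station $Y$ with power $a|U-Y|^{-\alpha}$, and $\sigma^2$ is the noise variance. The interference power at $Y_0$ is $I=\sum_{Y\in\Phi\setminus(\{Y_0\}\cup\mathcal{C})}p|U_Y|^{-\alpha}$, and the outage probability is $$P_{\mathsf{out}}(\lambda_b,p)=\Pr\left(\frac{p|U_0|^{-\alpha}}{I+\sigma^2}<\theta\right).$$ *)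

theory Defs
  imports "HOL-Probability.Probability"
begin

text \<open>
  A simple point process is a random locally finite set \<open>\<Phi>\<close>.  The counts \<open>card (\<Phi> \<omega> \<inter> B)\<close> are
  meaningful because of almost sure local finiteness (\<open>card\<close> of an infinite set is \<open>0\<close>).
  The pmf is written out because \<^term>\<open>poisson_pmf\<close> is only specified for positive rates, whereas
  \<open>B\<close> may be a null set here.
\<close>

locale homogeneous_ppp = prob_space M
  for M :: "'w measure" +
  fixes lam :: real
    and \<Phi> :: "'w \<Rightarrow> 'a::euclidean_space set"
  assumes lam_pos: "lam > 0"
    and locally_finite: "AE \<omega> in M. \<forall>B. bounded B \<longrightarrow> finite (\<Phi> \<omega> \<inter> B)"
    and count_poisson: "\<And>B k. B \<in> sets borel \<Longrightarrow> bounded B \<Longrightarrow>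
      prob {\<omega> \<in> space M. card (\<Phi> \<omega> \<inter> B) = k} =
        (lam * measure lborel B) ^ k / fact k * exp (- (lam * measure lborel B))"
    and count_indep: "\<And>\<B>. finite \<B> \<Longrightarrow> disjoint \<B> \<Longrightarrow>
      (\<And>B. B \<in> \<B> \<Longrightarrow> B \<in> sets borel \<and> bounded B) \<Longrightarrow>
      indep_vars (\<lambda>_. count_space UNIV) (\<lambda>B \<omega>. card (\<Phi> \<omega> \<inter> B)) \<B>"

definition voronoi_cell :: "'a::metric_space set \<Rightarrow> 'a \<Rightarrow> 'a set" where
  "voronoi_cell \<Phi> y = {x. \<forall>z\<in>\<Phi>. dist x y \<le> dist x z}"

text \<open>
  \<open>Y 0\<close> is the typical base station, at the origin; \<open>Y 1, Y 2, \<dots>\<close> are the remaining base stations,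
  labelled by increasing distance to the origin (almost surely these distances are distinct, so
  this labelling always exists).  Under this labelling the sequence \<open>Y\<close> and the set
  \<open>\<Phi> = range Y\<close> determine each other, so that conditioning on \<open>\<Phi>\<close> is conditioning on the
  sigma-algebra generated by \<open>Y\<close>.  \<open>U n\<close> is the active mobile served by \<open>Y n\<close>.
\<close>

locale cellular_uplink = prob_space M
  for M :: "'w measure" +
  fixes lam :: real
    and Y U :: "nat \<Rightarrow> 'w \<Rightarrow> real ^ 2"
  assumes Y_measurable: "\<And>n. Y n \<in> borel_measurable M"
    and U_measurable: "\<And>n. U n \<in> borel_measurable M"
    and Y_origin: "\<And>\<omega>. \<omega> \<in> space M \<Longrightarrow> Y 0 \<omega> = 0"
    and Y_ordered: "AE \<omega> in M. strict_mono (\<lambda>n. norm (Y n \<omega>))"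
    and Y_poisson: "homogeneous_ppp M lam (\<lambda>\<omega>. range (\<lambda>n. Y n \<omega>) - {0})"
    and U_cond_indep_uniform: "\<And>J B. finite J \<Longrightarrow> (\<And>n. n \<in> J \<Longrightarrow> B n \<in> sets borel) \<Longrightarrow>
      AE \<omega> in M.
        real_cond_exp M (vimage_algebra (space M) (\<lambda>\<omega> n. Y n \<omega>) (Pi\<^sub>M UNIV (\<lambda>_. borel)))
          (indicator {\<omega> \<in> space M. \<forall>n\<in>J. U n \<omega> \<in> B n}) \<omega> =
        (\<Prod>n\<in>J. measure (uniform_measure lborel (voronoi_cell (range (\<lambda>m. Y m \<omega>)) (Y n \<omega>))) (B n))"

text \<open>
  Labels of the base stations whose mobiles are the \<open>K\<close> interfering mobiles nearest to the origin,
  as a function of the mobile locations \<open>u\<close>.  Ties, which have probability zero, are broken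
  by the label, so that there are exactly \<open>K\<close> of them, see \<open>cancelled_nearest\<close> below.
\<close>

definition closer_interferers :: "(nat \<Rightarrow> 'a::real_normed_vector) \<Rightarrow> nat \<Rightarrow> nat set" where
  "closer_interferers u n =
     {m. m \<noteq> 0 \<and> (norm (u m) < norm (u n) \<or> norm (u m) = norm (u n) \<and> m < n)}"

definition cancelled :: "nat \<Rightarrow> (nat \<Rightarrow> 'a::real_normed_vector) \<Rightarrow> nat set" where
  "cancelled K u = {n. n \<noteq> 0 \<and> finite (closer_interferers u n) \<and> card (closer_interferers u n) < K}"

text \<open>
  The sums below converge almost surely: the origin is a base station, so a mobile in the cell of
  \<open>Y n\<close> has distance at least \<open>norm (Y n) / 2\<close> from it, and the path loss exponent exceeds \<open>2\<close>.
\<close>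

definition interference :: "real \<Rightarrow> real \<Rightarrow> nat \<Rightarrow> (nat \<Rightarrow> 'a::real_normed_vector) \<Rightarrow> real" where
  "interference \<alpha> p K u = (\<Sum>\<^sub>\<infinity>n\<in>- ({0} \<union> cancelled K u). p * norm (u n) powr (- \<alpha>))"

text \<open>The parameter \<open>\<sigma>\<close> is the square root of the noise variance.\<close>

definition outage_prob ::
  "'w measure \<Rightarrow> (nat \<Rightarrow> 'w \<Rightarrow> real ^ 2) \<Rightarrow> real \<Rightarrow> real \<Rightarrow> real \<Rightarrow> nat \<Rightarrow> real \<Rightarrow> real" where
  "outage_prob M U \<alpha> \<theta> \<sigma> K p =
     measure M {\<omega> \<in> space M.
       p * norm (U 0 \<omega>) powr (- \<alpha>) / (interference \<alpha> p K (\<lambda>n. U n \<omega>) + \<sigma>\<^sup>2) < \<theta>}"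

lemma cancelled_nearest:
  fixes u :: "nat \<Rightarrow> 'a::real_normed_vector"
  assumes lf: "\<And>r. finite {n. norm (u n) \<le> r}"
  shows "finite (cancelled K u)" "card (cancelled K u) = K" "0 \<notin> cancelled K u"
    "\<And>i j. i \<in> cancelled K u \<Longrightarrow> j \<noteq> 0 \<Longrightarrow> j \<notin> cancelled K u \<Longrightarrow> norm (u i) \<le> norm (u j)"
proof -
  let ?C = "closer_interferers u"
  have fin: "finite (?C n)" for n
    by (rule finite_subset[OF _ lf[of "norm (u n)"]]) (auto simp: closer_interferers_def)
  have sub: "insert i (?C i) \<subseteq> ?C j" if "i \<noteq> 0" "i \<in> ?C j" for i j
    using that by (auto simp: closer_interferers_def)
  have irr: "i \<notin> ?C i" for i by (auto simp: closer_interferers_def)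
  have lt: "card (?C i) < card (?C j)" if "i \<noteq> 0" "i \<in> ?C j" for i j
    using card_mono[OF fin[of j] sub[OF that]] irr[of i] fin[of i] by simp
  have total: "i \<in> ?C j \<or> j \<in> ?C i" if "i \<noteq> j" "i \<noteq> 0" "j \<noteq> 0" for i j
    using that by (auto simp: closer_interferers_def)
  show "0 \<notin> cancelled K u" by (simp add: cancelled_def)
  show "norm (u i) \<le> norm (u j)" if "i \<in> cancelled K u" "j \<noteq> 0" "j \<notin> cancelled K u" for i j
  proof (rule ccontr)
    assume "\<not> norm (u i) \<le> norm (u j)"
    then have "j \<in> ?C i" using that by (auto simp: closer_interferers_def)
    then show False using lt[of j i] that fin by (auto simp: cancelled_def)
  qed
  have inj: "inj_on (\<lambda>n. card (?C n)) A" if "0 \<notin> A" for A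
  proof (rule inj_onI, rule ccontr)
    fix i j assume ij: "i \<in> A" "j \<in> A" "card (?C i) = card (?C j)" "i \<noteq> j"
    then have "i \<noteq> 0" "j \<noteq> 0" using that by metis+
    then show False using total[of i j] lt[of i j] lt[of j i] ij by linarith
  qed
  have ex: "\<exists>n. n \<noteq> 0 \<and> card (?C n) = k" for k
  proof (induction k rule: less_induct)
    case (less k)
    define S where "S = {n. n \<noteq> 0 \<and> card (?C n) < k}"
    have S0: "0 \<notin> S" by (simp add: S_def)
    have "(\<lambda>n. card (?C n)) ` S = {..<k}"
    proof
      show "{..<k} \<subseteq> (\<lambda>n. card (?C n)) ` S"
      proof
        fix l assume l: "l \<in> {..<k}"
        then obtain n where "n \<noteq> 0" "card (?C n) = l" using less[of l] by blast
        then show "l \<in> (\<lambda>n. card (?C n)) ` S" using l by (intro image_eqI[of _ _ n]) (simp_all add: S_def)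
      qed
    qed (simp add: S_def image_subset_iff)
    then have finS: "finite S" and cardS: "card S = k"
      using finite_image_iff[OF inj[OF S0]] card_image[OF inj[OF S0]] by simp_all
    have "finite (insert 0 S)" using finS by simp
    then obtain a where a: "a \<noteq> 0" "a \<notin> S" using ex_new_if_finite[OF infinite_UNIV_nat] by blast
    define b where "b = (ARG_MIN (\<lambda>n. card (?C n)) n. n \<noteq> 0 \<and> n \<notin> S)"
    have b: "b \<noteq> 0 \<and> b \<notin> S"
      unfolding b_def by (rule arg_min_natI[where P = "\<lambda>n. n \<noteq> 0 \<and> n \<notin> S"]) (use a in blast)
    have b_le: "card (?C b) \<le> card (?C n)" if "n \<noteq> 0" "n \<notin> S" for n
      unfolding b_def by (rule arg_min_nat_le) (use that in blast)
    have "?C b \<subseteq> S"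
    proof
      fix n assume n: "n \<in> ?C b"
      then have n0: "n \<noteq> 0" by (simp add: closer_interferers_def)
      show "n \<in> S" using lt[OF n0 n] b_le[OF n0] by (meson not_le)
    qed
    then have "card (?C b) \<le> k" using card_mono[OF finS] cardS by metis
    moreover have "\<not> card (?C b) < k" using b unfolding S_def by blast
    ultimately show ?case using b by (intro exI[of _ b]) simp
  qed
  have im: "(\<lambda>n. card (?C n)) ` cancelled K u = {..<K}"
  proof
    show "{..<K} \<subseteq> (\<lambda>n. card (?C n)) ` cancelled K u"
    proof
      fix l assume l: "l \<in> {..<K}"
      obtain n where "n \<noteq> 0" "card (?C n) = l" using ex by blast
      then show "l \<in> (\<lambda>n. card (?C n)) ` cancelled K u"
        using l fin by (intro image_eqI[of _ _ n]) (simp_all add: cancelled_def)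
    qed
  qed (simp add: cancelled_def image_subset_iff)
  have inj': "inj_on (\<lambda>n. card (?C n)) (cancelled K u)"
    by (rule inj) (simp add: cancelled_def)
  show "finite (cancelled K u)" using finite_image_iff[OF inj'] im by simp
  show "card (cancelled K u) = K" using card_image[OF inj'] im by simp
qed

end

theory Submission
  imports Defs
begin

text \<open>
  Multiplying all locations by \<open>sqrt lam\<close> turns a network of density \<open>lam\<close> into one of density 1, and
  the axioms determine the joint law of the mobiles: the counts of a Poisson process determine the law
  of its points ordered by norm, and given these the mobiles are independent with a known law.  Hence
  the outage probability at \<open>(lam, p)\<close> is \<open>P(X + \<sigma>\<^sup>2 / q > 0)\<close> with \<open>q = p * lam powr (\<alpha> / 2)\<close>, where \<open>X\<close> is
  the uncancelled interference minus \<open>1 / \<theta>\<close> times the received signal power in the unit density network.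

  This is monotone in \<open>\<sigma>\<^sup>2 / q\<close>, so it remains to see that it increases strictly at \<open>\<mu>\<close>, that is, that
  \<open>X\<close> charges every interval \<open>(- s, - \<mu>]\<close> with \<open>s > \<mu>\<close>.  With positive probability there is no other base
  station in a large ball and the path loss summed over all base stations is tiny.  Then the interference
  is tiny, as a mobile is at least half as far from the origin as its base station, while the cell of
  the origin contains a whole annulus on which the signal term lies in a prescribed interval.
\<close>

section \<open>Counts of a Poisson process\<close>

text \<open>Networks of different densities live on unrelated probability spaces, so nothing can be
  compared pathwise. Only laws can, and the axioms fix no more than the laws of finitely many
  disjoint counts. The uniqueness argument therefore climbs from these to overlapping sets, to the
  field of all counts, to the labelled stations and to the mobiles, on whose law alone the outage
  depends.

  Path loss is not averaged point by point: every point is charged the inner radius of its dyadic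
  shell, which turns the mean into a series of mean counts. All shells avoid the ball that is to be
  empty, so by independence emptiness leaves this mean unchanged, and the mean tends to 0 as the
  ball grows because \<alpha> > 2. A first moment bound thus suffices, although the empty ball is a
  rare event.

  Two default values need care. A uniform law on a cell of zero or infinite area is the zero
  measure; at the origin the conditional axiom itself excludes this. A divergent
  \<open>infsum\<close> is 0; the path loss bound excludes this almost surely.\<close>

lemma (in homogeneous_ppp) count_measurable:
  assumes "B \<in> sets borel" "bounded B"
  shows "(\<lambda>\<omega>. card (\<Phi> \<omega> \<inter> B)) \<in> measurable M (count_space UNIV)"
proof -
  \<comment> \<open>Measurability of a count is not an axiom of its own; independence of the
    one-element family \<open>{B}\<close> contains it.\<close>
  have "indep_vars (\<lambda>_. count_space UNIV) (\<lambda>B \<omega>. card (\<Phi> \<omega> \<inter> B)) {B}"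
    using assms by (intro count_indep) auto
  then show ?thesis by (simp add: indep_vars_def2)
qed

lemma poisson_mean_sums:
  fixes m :: real
  shows "(\<lambda>k. real k * (m ^ k / fact k * exp (- m))) sums m"
proof -
  have "(\<lambda>k. m ^ k / fact k) sums exp m"
    using exp_converges[of m] by (simp add: scaleR_conv_of_real field_simps)
  then have "(\<lambda>k. m * exp (- m) * (m ^ k / fact k)) sums (m * exp (- m) * exp m)"
    by (rule sums_mult)
  moreover have "m * exp (- m) * (m ^ k / fact k) =
      real (Suc k) * (m ^ Suc k / fact (Suc k) * exp (- m))" for k
    by (simp add: field_simps del: of_nat_Suc)
  moreover have "m * exp (- m) * exp m = m" by (simp add: mult_exp_exp)
  ultimately have "(\<lambda>k. real (Suc k) * (m ^ Suc k / fact (Suc k) * exp (- m))) sums m"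
    by (simp only:)
  \<comment> \<open>The term k = 0 that is put back vanishes.\<close>
  from sums_Suc[OF this] show ?thesis by simp
qed

lemma (in homogeneous_ppp) count_mean:
  assumes B: "B \<in> sets borel" "bounded B"
  shows "(\<integral>\<^sup>+\<omega>. of_nat (card (\<Phi> \<omega> \<inter> B)) \<partial>M) = ennreal (lam * measure lborel B)"
proof -
  let ?N = "\<lambda>\<omega>. card (\<Phi> \<omega> \<inter> B)" and ?m = "lam * measure lborel B"
  note [measurable] = count_measurable[OF B]
  have m: "0 \<le> ?m" using lam_pos by simp
  have "(\<integral>\<^sup>+\<omega>. of_nat (?N \<omega>) \<partial>M) =
      (\<integral>\<^sup>+\<omega>. (\<Sum>k. of_nat k * indicator {\<omega> \<in> space M. ?N \<omega> = k} \<omega>) \<partial>M)"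
    by (intro nn_integral_cong suminf_cmult_indicator[symmetric]) (auto simp: disjoint_family_on_def)
  also have "\<dots> = (\<Sum>k. of_nat k * emeasure M {\<omega> \<in> space M. ?N \<omega> = k})"
    by (subst nn_integral_suminf) (auto intro!: suminf_cong nn_integral_cmult_indicator)
  also have "\<dots> = (\<Sum>k. ennreal (real k * (?m ^ k / fact k * exp (- ?m))))"
    by (subst ennreal_mult')
      (simp_all add: emeasure_eq_measure count_poisson[OF B] ennreal_of_nat_eq_real_of_nat)
  also have "\<dots> = ennreal ?m"
    by (rule suminf_ennreal_eq[OF _ poisson_mean_sums]) (use m in simp)
  finally show ?thesis .
qed

text \<open>Meant for a shell \<open>B\<close> and the ball \<open>C\<close> inside it: by
  independence, an empty ball does not bias the count of a disjoint region.
  \<open>B \<noteq> C\<close> excludes the case that both are empty, where a family indexed by the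
  sets themselves collapses to one member.\<close>

lemma (in homogeneous_ppp) count_mean_void:
  assumes B: "B \<in> sets borel" "bounded B" and C: "C \<in> sets borel" "bounded C"
    and disj: "B \<inter> C = {}" "B \<noteq> C"
  shows "(\<integral>\<^sup>+\<omega>. of_nat (card (\<Phi> \<omega> \<inter> B)) * indicator {\<omega> \<in> space M. card (\<Phi> \<omega> \<inter> C) = 0} \<omega> \<partial>M) =
    ennreal (lam * measure lborel B) * emeasure M {\<omega> \<in> space M. card (\<Phi> \<omega> \<inter> C) = 0}"
proof -
  note [measurable] = count_measurable[OF B] count_measurable[OF C]
  \<comment> \<open>The product formula wants one family of functionals indexed by the two sets: the
    void indicator at \<open>C\<close>, the count itself at \<open>B\<close>.\<close>
  define X :: "'a set \<Rightarrow> nat \<Rightarrow> ennreal" where "X D = (if D = C then indicator {0} else of_nat)" for D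
  have "indep_vars (\<lambda>_. count_space UNIV) (\<lambda>B \<omega>. card (\<Phi> \<omega> \<inter> B)) {B, C}"
    using B C disj by (intro count_indep) (auto simp: disjoint_def)
  then have "indep_vars (\<lambda>_. borel) (\<lambda>D \<omega>. X D (card (\<Phi> \<omega> \<inter> D))) {B, C}"
    by (rule indep_vars_compose2) simp
  from indep_vars_nn_integral[OF _ this] have
    "(\<integral>\<^sup>+\<omega>. X B (card (\<Phi> \<omega> \<inter> B)) * X C (card (\<Phi> \<omega> \<inter> C)) \<partial>M) =
     (\<integral>\<^sup>+\<omega>. X B (card (\<Phi> \<omega> \<inter> B)) \<partial>M) * (\<integral>\<^sup>+\<omega>. X C (card (\<Phi> \<omega> \<inter> C)) \<partial>M)"
    using disj by simp
  moreover have "X C (card (\<Phi> \<omega> \<inter> C)) = indicator {\<omega> \<in> space M. card (\<Phi> \<omega> \<inter> C) = 0} \<omega>"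
    if "\<omega> \<in> space M" for \<omega>
    using that by (simp add: X_def indicator_def)
  ultimately show ?thesis
    using disj by (simp add: X_def[of B] count_mean[OF B] cong: nn_integral_cong)
qed

section \<open>Uniqueness of the joint law of all counts\<close>

definition bounded_borel :: "'a::euclidean_space set set" where
  "bounded_borel = {B. B \<in> sets borel \<and> bounded B}"

text \<open>Encodes a configuration as a point of a product of countable spaces, so that its law is
  an ordinary measure on \<open>Pi\<^sub>M\<close> and no sigma-algebra on sets of points has to be
  introduced.\<close>

definition count_field :: "'a set \<Rightarrow> 'a::euclidean_space set \<Rightarrow> nat" where
  "count_field S = (\<lambda>B\<in>bounded_borel. card (S \<inter> B))"

lemma (in homogeneous_ppp) count_field_measurable:
  "(\<lambda>\<omega>. count_field (\<Phi> \<omega>)) \<in> measurable M (Pi\<^sub>M bounded_borel (\<lambda>_. count_space UNIV))"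
  unfolding count_field_def
  by (intro measurable_restrict) (auto simp: bounded_borel_def intro: count_measurable)

lemma homogeneous_ppp_count_law_unique:
  assumes "homogeneous_ppp M lam \<Phi>" "homogeneous_ppp M' lam \<Phi>'"
    and "B \<in> sets borel" "bounded B"
  shows "distr M (count_space UNIV) (\<lambda>\<omega>. card (\<Phi> \<omega> \<inter> B)) =
    distr M' (count_space UNIV) (\<lambda>\<omega>. card (\<Phi>' \<omega> \<inter> B))"
proof -
  interpret P: homogeneous_ppp M lam \<Phi> by fact
  interpret P': homogeneous_ppp M' lam \<Phi>' by fact
  note [measurable] = P.count_measurable[OF assms(3,4)] P'.count_measurable[OF assms(3,4)]
  show ?thesis
  proof (rule measure_eqI_countable)
    fix k :: nat
    have "(\<lambda>\<omega>. card (\<Phi> \<omega> \<inter> B)) -` {k} \<inter> space M = {\<omega> \<in> space M. card (\<Phi> \<omega> \<inter> B) = k}"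
      "(\<lambda>\<omega>. card (\<Phi>' \<omega> \<inter> B)) -` {k} \<inter> space M' = {\<omega> \<in> space M'. card (\<Phi>' \<omega> \<inter> B) = k}" by auto
    then show "emeasure (distr M (count_space UNIV) (\<lambda>\<omega>. card (\<Phi> \<omega> \<inter> B))) {k} =
      emeasure (distr M' (count_space UNIV) (\<lambda>\<omega>. card (\<Phi>' \<omega> \<inter> B))) {k}"
      by (simp add: emeasure_distr P.emeasure_eq_measure P'.emeasure_eq_measure
        P.count_poisson[OF assms(3,4)] P'.count_poisson[OF assms(3,4)])
  qed auto
qed

text \<open>The sets in \<^term>\<open>J\<close> need not be disjoint; their counts are sums of the counts of the atoms of
  the algebra they generate.\<close>

definition atom :: "'a set set \<Rightarrow> 'a set set \<Rightarrow> 'a set" where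
  "atom J S = \<Inter>S - \<Union>(J - S)"

text \<open>The empty subfamily is left out because its atom is the complement of
  \<open>\<Union>J\<close>, which is unbounded. Being a set of sets, \<open>atoms J\<close> contains
  the empty atom at most once, as the disjointness in \<open>count_indep\<close> requires.\<close>

definition atoms :: "'a set set \<Rightarrow> 'a set set" where
  "atoms J = atom J ` (Pow J - {{}})"

lemma atoms_bounded_borel:
  assumes "finite J" "J \<subseteq> bounded_borel" "A \<in> atoms J"
  shows "A \<in> sets borel \<and> bounded A"
proof -
  obtain S where S: "S \<subseteq> J" "S \<noteq> {}" "A = \<Inter>S - \<Union>(J - S)"
    using assms(3) by (auto simp: atoms_def atom_def)
  then obtain B where B: "B \<in> S" by blast
  have "bounded A" by (rule bounded_subset[of B]) (use B S assms(2) in \<open>auto simp: bounded_borel_def\<close>)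
  moreover have "\<Inter>S \<in> sets borel" "\<Union>(J - S) \<in> sets borel"
    using S assms finite_subset[of S J] sets.finite_INT[of S "\<lambda>x. x" borel]
    by (auto intro!: sets.finite_Union simp: bounded_borel_def subset_iff)
  ultimately show ?thesis using S by auto
qed

lemma atom_of_point: "x \<in> \<Union>J \<Longrightarrow> x \<in> atom J {B \<in> J. x \<in> B} \<and> atom J {B \<in> J. x \<in> B} \<in> atoms J"
  by (auto simp: atoms_def atom_def)

lemma atom_unique: "S \<subseteq> J \<Longrightarrow> x \<in> atom J S \<Longrightarrow> S = {B \<in> J. x \<in> B}"
  by (auto simp: atom_def)

lemma disjoint_atoms: "disjoint (atoms J)"
  unfolding disjoint_def
proof (intro ballI impI)
  fix A A' assume AA: "A \<in> atoms J" "A' \<in> atoms J" "A \<noteq> A'"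
  then obtain S S' where S: "S \<subseteq> J" "S' \<subseteq> J" "A = atom J S" "A' = atom J S'" by (auto simp: atoms_def)
  have "x \<notin> A'" if "x \<in> A" for x using atom_unique[of S J x] atom_unique[of S' J x] S that AA(3) by auto
  then show "A \<inter> A' = {}" by auto
qed

text \<open>Finiteness matters: \<open>card\<close> of an infinite set is 0, so additivity may fail
  without it. This is why the counts of overlapping sets are recovered only almost surely.\<close>

lemma card_Int_eq_sum_atoms:
  assumes "finite J" "B \<in> J" "finite (X \<inter> B)"
  shows "card (X \<inter> B) = (\<Sum>A\<in>{A \<in> atoms J. A \<subseteq> B}. card (X \<inter> A))"
proof -
  have fin: "finite (atoms J)" using assms by (simp add: atoms_def)
  have "X \<inter> B = (\<Union>A\<in>{A \<in> atoms J. A \<subseteq> B}. X \<inter> A)"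
  proof
    show "X \<inter> B \<subseteq> (\<Union>A\<in>{A \<in> atoms J. A \<subseteq> B}. X \<inter> A)"
    proof
      fix x assume x: "x \<in> X \<inter> B"
      then have "x \<in> \<Union>J" using assms by auto
      from atom_of_point[OF this] x assms(2) show "x \<in> (\<Union>A\<in>{A \<in> atoms J. A \<subseteq> B}. X \<inter> A)"
        by (intro UN_I[of "atom J {B \<in> J. x \<in> B}"]) (auto simp: atom_def)
    qed
  qed auto
  moreover have "card (\<Union>A\<in>{A \<in> atoms J. A \<subseteq> B}. X \<inter> A) = (\<Sum>A\<in>{A \<in> atoms J. A \<subseteq> B}. card (X \<inter> A))"
    using fin disjoint_atoms[of J] by (intro card_UN_disjoint)
      (auto simp: disjoint_def intro: finite_subset[OF _ assms(3)])
  ultimately show ?thesis by simp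
qed

text \<open>The counts of the atoms are independent, so their joint law is a product of
  one-dimensional laws. The right-hand side is written in terms of these alone, which makes it agree
  for any two processes of the same density.\<close>

lemma (in homogeneous_ppp) finite_counts_law:
  assumes J: "finite J" "J \<subseteq> bounded_borel" and J0: "J \<noteq> {}"
  shows "emeasure M {\<omega> \<in> space M. \<forall>B\<in>J. card (\<Phi> \<omega> \<inter> B) \<in> A B} =
    emeasure (Pi\<^sub>M (atoms J) (\<lambda>B. distr M (count_space UNIV) (\<lambda>\<omega>. card (\<Phi> \<omega> \<inter> B))))
      {f \<in> space (Pi\<^sub>M (atoms J) (\<lambda>_. count_space UNIV)).
        \<forall>B\<in>J. (\<Sum>A\<in>{A \<in> atoms J. A \<subseteq> B}. f A) \<in> A B}"
proof -
  define I where "I = atoms J"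
  have I: "finite I" "I \<noteq> {}" "disjoint I" "\<And>A. A \<in> I \<Longrightarrow> A \<in> sets borel \<and> bounded A"
    using J J0 disjoint_atoms[of J] atoms_bounded_borel[OF J] by (auto simp: I_def atoms_def)
  let ?Q = "{f \<in> space (Pi\<^sub>M I (\<lambda>_. count_space UNIV)). \<forall>B\<in>J. (\<Sum>A\<in>{A \<in> I. A \<subseteq> B}. f A) \<in> A B}"
  have Q: "?Q \<in> sets (Pi\<^sub>M I (\<lambda>_. count_space (UNIV :: nat set)))"
    using J by measurable
  let ?f = "\<lambda>\<omega>. \<lambda>B\<in>I. card (\<Phi> \<omega> \<inter> B)"
  have indep: "indep_vars (\<lambda>_. count_space UNIV) (\<lambda>B \<omega>. card (\<Phi> \<omega> \<inter> B)) I"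
    using I by (intro count_indep) auto
  have f: "?f \<in> measurable M (Pi\<^sub>M I (\<lambda>_. count_space UNIV))"
    using I by (intro measurable_restrict count_measurable) auto
  have "(\<lambda>\<omega>. count_field (\<Phi> \<omega>)) -` {f \<in> space (Pi\<^sub>M bounded_borel (\<lambda>_. count_space UNIV)). \<forall>B\<in>J. f B \<in> A B}
      \<inter> space M \<in> sets M"
  proof (rule measurable_sets[OF count_field_measurable])
    have "Measurable.pred (Pi\<^sub>M bounded_borel (\<lambda>_. count_space (UNIV :: nat set)))
      (\<lambda>f. \<forall>B\<in>J. f B \<in> A B)"
    proof (rule pred_intros_finite(3)[OF J(1)])
      fix B :: "'a set" assume "B \<in> J"
      then have "(\<lambda>f. f B) \<in> measurable (Pi\<^sub>M bounded_borel (\<lambda>_. count_space (UNIV :: nat set))) (count_space UNIV)"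
        using J(2) by (intro measurable_component_singleton) auto
      then show "Measurable.pred (Pi\<^sub>M bounded_borel (\<lambda>_. count_space (UNIV :: nat set))) (\<lambda>f. f B \<in> A B)"
        by measurable
    qed
    then show "{f \<in> space (Pi\<^sub>M bounded_borel (\<lambda>_. count_space (UNIV :: nat set))). \<forall>B\<in>J. f B \<in> A B} \<in>
      sets (Pi\<^sub>M bounded_borel (\<lambda>_. count_space UNIV))" by (simp add: pred_def)
  qed
  also have "(\<lambda>\<omega>. count_field (\<Phi> \<omega>)) -` {f \<in> space (Pi\<^sub>M bounded_borel (\<lambda>_. count_space UNIV)). \<forall>B\<in>J. f B \<in> A B}
      \<inter> space M = {\<omega> \<in> space M. \<forall>B\<in>J. card (\<Phi> \<omega> \<inter> B) \<in> A B}"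
    using J(2) measurable_space[OF count_field_measurable] by (auto simp: count_field_def subset_iff)
  finally have [measurable]: "{\<omega> \<in> space M. \<forall>B\<in>J. card (\<Phi> \<omega> \<inter> B) \<in> A B} \<in> sets M" .
  \<comment> \<open>Local finiteness enters here: it makes the count of each member of
    \<open>J\<close> the sum of the counts of its atoms.\<close>
  have "AE \<omega> in M. \<omega> \<in> {\<omega> \<in> space M. \<forall>B\<in>J. card (\<Phi> \<omega> \<inter> B) \<in> A B} \<longleftrightarrow> \<omega> \<in> ?f -` ?Q \<inter> space M"
    using locally_finite
  proof (eventually_elim)
    case (elim \<omega>)
    have "(\<Sum>A\<in>{A \<in> I. A \<subseteq> B}. ?f \<omega> A) = card (\<Phi> \<omega> \<inter> B)" if "B \<in> J" for B
    proof -
      have "finite (\<Phi> \<omega> \<inter> B)" using elim that J by (auto simp: bounded_borel_def)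
      from card_Int_eq_sum_atoms[OF J(1) that this] show ?thesis by (simp add: I_def)
    qed
    then show ?case by (auto simp: space_PiM)
  qed
  then have "emeasure M {\<omega> \<in> space M. \<forall>B\<in>J. card (\<Phi> \<omega> \<inter> B) \<in> A B} = emeasure M (?f -` ?Q \<inter> space M)"
    by (rule emeasure_eq_AE) (use measurable_sets[OF f Q] in auto)
  also have "\<dots> = emeasure (distr M (Pi\<^sub>M I (\<lambda>_. count_space UNIV)) ?f) ?Q"
    by (rule emeasure_distr[symmetric, OF f Q])
  also have "distr M (Pi\<^sub>M I (\<lambda>_. count_space UNIV)) ?f =
      Pi\<^sub>M I (\<lambda>B. distr M (count_space UNIV) (\<lambda>\<omega>. card (\<Phi> \<omega> \<inter> B)))"
    using indep I by (subst indep_vars_iff_distr_eq_PiM'[symmetric]) (auto intro: count_measurable)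
  finally show ?thesis unfolding I_def .
qed

lemma homogeneous_ppp_finite_counts_unique:
  assumes P: "homogeneous_ppp M lam \<Phi>" and P': "homogeneous_ppp M' lam \<Phi>'"
    and J: "finite J" "J \<subseteq> bounded_borel"
  shows "emeasure M {\<omega> \<in> space M. \<forall>B\<in>J. card (\<Phi> \<omega> \<inter> B) \<in> A B} =
    emeasure M' {\<omega> \<in> space M'. \<forall>B\<in>J. card (\<Phi>' \<omega> \<inter> B) \<in> A B}"
proof (cases "J = {}")
  case True
  then show ?thesis using P P' by (simp add: homogeneous_ppp_def prob_space.emeasure_space_1)
next
  case False
  have "Pi\<^sub>M (atoms J) (\<lambda>B. distr M (count_space UNIV) (\<lambda>\<omega>. card (\<Phi> \<omega> \<inter> B))) =
      Pi\<^sub>M (atoms J) (\<lambda>B. distr M' (count_space UNIV) (\<lambda>\<omega>. card (\<Phi>' \<omega> \<inter> B)))"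
    using atoms_bounded_borel[OF J]
    by (intro PiM_cong homogeneous_ppp_count_law_unique[OF P P']) auto
  then show ?thesis
    using homogeneous_ppp.finite_counts_law[OF P J False] homogeneous_ppp.finite_counts_law[OF P' J False]
    by simp
qed

text \<open>A finite measure on the product is determined by the cylinders, each of which constrains
  only finitely many counts.\<close>

lemma homogeneous_ppp_count_field_law_unique:
  assumes P: "homogeneous_ppp M lam \<Phi>" and P': "homogeneous_ppp M' lam \<Phi>'"
  shows "distr M (Pi\<^sub>M bounded_borel (\<lambda>_. count_space UNIV)) (\<lambda>\<omega>. count_field (\<Phi> \<omega>)) =
    distr M' (Pi\<^sub>M bounded_borel (\<lambda>_. count_space UNIV)) (\<lambda>\<omega>. count_field (\<Phi>' \<omega>))"
proof -
  interpret P: homogeneous_ppp M lam \<Phi> by fact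
  interpret P': homogeneous_ppp M' lam \<Phi>' by fact
  show ?thesis
  proof (rule measure_eqI_PiM_infinite)
    show "finite_measure (distr M (Pi\<^sub>M bounded_borel (\<lambda>_. count_space UNIV)) (\<lambda>\<omega>. count_field (\<Phi> \<omega>)))"
      by (intro P.finite_measure_distr P.count_field_measurable)
    fix A J assume J: "finite J" "J \<subseteq> (bounded_borel :: 'b set set)"
    let ?E = "prod_emb bounded_borel (\<lambda>_. count_space (UNIV :: nat set)) J (Pi\<^sub>E J A)"
    have E: "?E \<in> sets (Pi\<^sub>M bounded_borel (\<lambda>_. count_space UNIV))"
      using J by (intro sets_PiM_I) auto
    have "(\<lambda>\<omega>. count_field (\<Phi> \<omega>)) -` ?E \<inter> space M = {\<omega> \<in> space M. \<forall>B\<in>J. card (\<Phi> \<omega> \<inter> B) \<in> A B}"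
      "(\<lambda>\<omega>. count_field (\<Phi>' \<omega>)) -` ?E \<inter> space M' = {\<omega> \<in> space M'. \<forall>B\<in>J. card (\<Phi>' \<omega> \<inter> B) \<in> A B}"
      using J(2) by (auto simp: prod_emb_def count_field_def PiE_iff subset_iff)
    then show "emeasure (distr M (Pi\<^sub>M bounded_borel (\<lambda>_. count_space UNIV)) (\<lambda>\<omega>. count_field (\<Phi> \<omega>))) ?E =
        emeasure (distr M' (Pi\<^sub>M bounded_borel (\<lambda>_. count_space UNIV)) (\<lambda>\<omega>. count_field (\<Phi>' \<omega>))) ?E"
      using homogeneous_ppp_finite_counts_unique[OF P P' J]
      by (simp add: emeasure_distr[OF P.count_field_measurable E] emeasure_distr[OF P'.count_field_measurable E])
  qed auto
qed

section \<open>Recovering the ordered points from the counts\<close>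

lemma distr_process_eqI:
  fixes X :: "nat \<Rightarrow> 'w \<Rightarrow> 'a::topological_space" and X' :: "nat \<Rightarrow> 'v \<Rightarrow> 'a"
  assumes "prob_space M" "prob_space M'"
    and X[measurable]: "\<And>n. X n \<in> borel_measurable M" "\<And>n. X' n \<in> borel_measurable M'"
    and eq: "\<And>J A. finite J \<Longrightarrow> (\<And>n. n \<in> J \<Longrightarrow> A n \<in> sets borel) \<Longrightarrow>
      emeasure M {\<omega> \<in> space M. \<forall>n\<in>J. X n \<omega> \<in> A n} = emeasure M' {\<omega> \<in> space M'. \<forall>n\<in>J. X' n \<omega> \<in> A n}"
  shows "distr M (Pi\<^sub>M UNIV (\<lambda>_. borel)) (\<lambda>\<omega> n. X n \<omega>) = distr M' (Pi\<^sub>M UNIV (\<lambda>_. borel)) (\<lambda>\<omega> n. X' n \<omega>)"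
proof (rule measure_eqI_PiM_infinite)
  have m: "(\<lambda>\<omega> n. X n \<omega>) \<in> measurable M (Pi\<^sub>M UNIV (\<lambda>_. borel))"
    "(\<lambda>\<omega> n. X' n \<omega>) \<in> measurable M' (Pi\<^sub>M UNIV (\<lambda>_. borel))"
    by (auto intro!: measurable_PiM_single' simp: space_PiM)
  interpret M: prob_space M by fact
  show "finite_measure (distr M (Pi\<^sub>M UNIV (\<lambda>_. borel)) (\<lambda>\<omega> n. X n \<omega>))"
    by (rule M.finite_measure_distr[OF m(1)])
  fix A and J :: "nat set" assume J: "finite J" "\<And>n. n \<in> J \<Longrightarrow> A n \<in> sets (borel :: 'a measure)"
  let ?E = "prod_emb (UNIV :: nat set) (\<lambda>_. borel) J (Pi\<^sub>E J A)"
  have E: "?E \<in> sets (Pi\<^sub>M UNIV (\<lambda>_. borel))" using J by (intro sets_PiM_I) auto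
  have "(\<lambda>\<omega> n. X n \<omega>) -` ?E \<inter> space M = {\<omega> \<in> space M. \<forall>n\<in>J. X n \<omega> \<in> A n}"
    "(\<lambda>\<omega> n. X' n \<omega>) -` ?E \<inter> space M' = {\<omega> \<in> space M'. \<forall>n\<in>J. X' n \<omega> \<in> A n}"
    by (auto simp: prod_emb_def PiE_iff)
  then show "emeasure (distr M (Pi\<^sub>M UNIV (\<lambda>_. borel)) (\<lambda>\<omega> n. X n \<omega>)) ?E =
      emeasure (distr M' (Pi\<^sub>M UNIV (\<lambda>_. borel)) (\<lambda>\<omega> n. X' n \<omega>)) ?E"
    using eq[OF J] by (simp add: emeasure_distr[OF m(1) E] emeasure_distr[OF m(2) E])
qed auto

lemma range_minus_origin:
  fixes y :: "nat \<Rightarrow> 'a::zero"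
  assumes "inj y" "y 0 = 0"
  shows "range y - {0} = y ` {0<..}"
proof -
  have "y ` (UNIV - {0}) = range y - {0}" using image_set_diff[OF assms(1), of UNIV "{0}"] assms(2) by simp
  moreover have "UNIV - {0} = {0::nat<..}" by auto
  ultimately show ?thesis by simp
qed

text \<open>Norms increase with the label, so the positive labels of the points in a centred ball
  form an initial segment \<open>{1..n}\<close>, and its length determines it.\<close>

lemma card_points_cball:
  fixes y :: "nat \<Rightarrow> 'a::real_normed_vector"
  assumes y: "y 0 = 0" "strict_mono (\<lambda>n. norm (y n))" and fin: "finite ((range y - {0}) \<inter> cball 0 q)"
  shows "card ((range y - {0}) \<inter> cball 0 q) = k \<longleftrightarrow> (\<forall>m>0. norm (y m) \<le> q \<longleftrightarrow> m \<le> k)"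
proof -
  have inj: "inj y" using strict_mono_eq[OF y(2)] by (simp add: inj_def) metis
  define I where "I = {m. m > 0 \<and> norm (y m) \<le> q}"
  have S: "(range y - {0}) \<inter> cball 0 q = y ` I"
    unfolding range_minus_origin[OF inj y(1)] by (auto simp: I_def)
  have I: "finite I" and card: "card (y ` I) = card I"
    using fin inj_on_subset[OF inj subset_UNIV, of I] by (simp_all add: S finite_image_iff card_image)
  have down: "m \<in> I" if "m > 0" "m \<le> n" "n \<in> I" for m n
    using that strict_mono_less_eq[OF y(2), of m n] by (auto simp: I_def)
  obtain n where n: "I = {1..n}"
  proof (cases "I = {}")
    case False
    have "m \<in> I \<longleftrightarrow> 1 \<le> m \<and> m \<le> Max I" for m
      using Max_ge[OF I, of m] down[of m, OF _ _ Max_in[OF I False]] by (auto simp: I_def Suc_le_eq)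
    then have "I = {1..Max I}" by (intro set_eqI) (simp only: atLeastAtMost_iff)
    then show ?thesis by (rule that)
  qed (use that[of 0] in simp)
  then have "card I = k \<longleftrightarrow> I = {1..k}" by (auto simp: n)
  also have "\<dots> \<longleftrightarrow> (\<forall>m>0. norm (y m) \<le> q \<longleftrightarrow> m \<le> k)"
    by (auto simp: I_def set_eq_iff Suc_le_eq)
  finally show ?thesis by (simp add: S card)
qed

text \<open>The \<open>n\<close>-th point is the only one in a suitable rational shell, so its position can be read off
  countably many counts.\<close>

definition nth_point_in :: "nat \<Rightarrow> 'a::euclidean_space set \<Rightarrow> ('a set \<Rightarrow> nat) \<Rightarrow> bool" where
  "nth_point_in n C f \<longleftrightarrow> (\<exists>q r :: rat. f (cball 0 (of_rat q)) = n - 1 \<and> f (cball 0 (of_rat r)) = n \<and>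
     f (C \<inter> (cball 0 (of_rat r) - cball 0 (of_rat q))) = 1)"

lemma bounded_borel_shell:
  "C \<in> sets borel \<Longrightarrow> C \<inter> (cball 0 r - cball 0 q) \<in> bounded_borel"
  by (auto simp: bounded_borel_def intro: bounded_subset[OF bounded_cball[of 0 r]])

lemma cball_bounded_borel: "cball 0 r \<in> bounded_borel"
  by (auto simp: bounded_borel_def)

lemma nth_point_in_measurable:
  assumes "C \<in> sets borel"
  shows "Measurable.pred (Pi\<^sub>M bounded_borel (\<lambda>_. count_space UNIV)) (nth_point_in n C)"
proof -
  have [measurable]: "(\<lambda>f. f B) \<in> measurable (Pi\<^sub>M bounded_borel (\<lambda>_. count_space (UNIV :: nat set))) (count_space UNIV)"
    if "B \<in> bounded_borel" for B :: "'a set"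
    using that by (rule measurable_component_singleton)
  note [simp] = cball_bounded_borel bounded_borel_shell[OF assms]
  show ?thesis unfolding nth_point_in_def by measurable
qed

lemma nth_point_in_iff:
  fixes y :: "nat \<Rightarrow> 'a::euclidean_space"
  assumes y: "y 0 = 0" "strict_mono (\<lambda>n. norm (y n))"
    and fin: "\<And>B. bounded B \<Longrightarrow> finite ((range y - {0}) \<inter> B)"
    and n: "n > 0" and C: "C \<in> sets borel"
  shows "nth_point_in n C (count_field (range y - {0})) \<longleftrightarrow> y n \<in> C"
proof -
  let ?S = "range y - {0}"
  have inj: "inj y" using strict_mono_eq[OF y(2)] by (simp add: inj_def) metis
  note cnt = card_points_cball[OF y fin[OF bounded_cball]]
  \<comment> \<open>Any two radii with counts n - 1 and n isolate the n-th point. Hence the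
    existential in \<open>nth_point_in\<close> gives the same answer for every witness, and one
    witness is enough for the converse.\<close>
  have shell: "?S \<inter> (C \<inter> (cball 0 r - cball 0 q)) = (if y n \<in> C then {y n} else {})"
    if "card (?S \<inter> cball 0 q) = n - 1" "card (?S \<inter> cball 0 r) = n" for q r
  proof -
    have only_n: "m > 0 \<and> norm (y m) \<le> r \<and> \<not> norm (y m) \<le> q \<longleftrightarrow> m = n" for m
    proof -
      have "m > 0 \<Longrightarrow> norm (y m) \<le> q \<longleftrightarrow> m \<le> n - 1" "m > 0 \<Longrightarrow> norm (y m) \<le> r \<longleftrightarrow> m \<le> n"
        using that unfolding cnt by blast+
      then show ?thesis using n by (cases "m > 0") (simp_all, arith)
    qed
    have "{m. (m > 0 \<and> norm (y m) \<le> r \<and> \<not> norm (y m) \<le> q) \<and> y m \<in> C} = (if y n \<in> C then {n} else {})"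
      unfolding only_n by (rule set_eqI) auto
    moreover have "?S \<inter> (C \<inter> (cball 0 r - cball 0 q)) =
        y ` {m. (m > 0 \<and> norm (y m) \<le> r \<and> \<not> norm (y m) \<le> q) \<and> y m \<in> C}"
      unfolding range_minus_origin[OF inj y(1)] by (rule set_eqI) (auto simp del: not_le)
    ultimately show ?thesis by simp
  qed
  \<comment> \<open>Radii strictly between consecutive norms serve as the witness; for n = 1 the
    inner neighbour is the origin.\<close>
  obtain q :: rat where q: "norm (y (n - 1)) < of_rat q" "of_rat q < norm (y n)"
    using of_rat_dense[OF strict_monoD[OF y(2), of "n - 1" n]] n by auto
  obtain r :: rat where r: "norm (y n) < of_rat r" "of_rat r < norm (y (Suc n))"
    using of_rat_dense[OF strict_monoD[OF y(2), of n "Suc n"]] by auto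
  have le: "norm (y m) \<le> norm (y m') \<longleftrightarrow> m \<le> m'" for m m' using strict_mono_less_eq[OF y(2)] .
  have cq: "card (?S \<inter> cball 0 (of_rat q)) = n - 1"
    unfolding cnt
  proof (intro allI impI)
    fix m :: nat assume "m > 0"
    show "norm (y m) \<le> of_rat q \<longleftrightarrow> m \<le> n - 1"
      using le[of m "n - 1"] le[of n m] q n by linarith
  qed
  have cr: "card (?S \<inter> cball 0 (of_rat r)) = n"
    unfolding cnt
  proof (intro allI impI)
    fix m :: nat assume "m > 0"
    show "norm (y m) \<le> of_rat r \<longleftrightarrow> m \<le> n"
      using le[of m n] le[of "Suc n" m] r n by linarith
  qed
  have count_field: "count_field ?S B = card (?S \<inter> B)" if "B \<in> bounded_borel" for B
    using that by (simp add: count_field_def)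
  show ?thesis
  proof
    assume "nth_point_in n C (count_field ?S)"
    then obtain q r :: rat where qr: "card (?S \<inter> cball 0 (of_rat q)) = n - 1" "card (?S \<inter> cball 0 (of_rat r)) = n"
      and one: "card (?S \<inter> (C \<inter> (cball 0 (of_rat r) - cball 0 (of_rat q)))) = 1"
      unfolding nth_point_in_def
      unfolding count_field[OF cball_bounded_borel] count_field[OF bounded_borel_shell[OF C]] by blast
    show "y n \<in> C" using one unfolding shell[OF qr] by (simp split: if_splits)
  next
    assume "y n \<in> C"
    then have "card (?S \<inter> (C \<inter> (cball 0 (of_rat r) - cball 0 (of_rat q)))) = 1"
      by (subst shell[OF cq cr]) simp
    with cq cr show "nth_point_in n C (count_field ?S)"
      unfolding nth_point_in_def
      by (intro exI[of _ q] exI[of _ r])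
        (simp only: count_field[OF cball_bounded_borel] count_field[OF bounded_borel_shell[OF C]] simp_thms)
  qed
qed

text \<open>Station 0 is removed from the counted points, so its constraint becomes the constant
  condition \<open>0 \<in> A 0\<close>. All other constraints are read off the counts, hence the
  right-hand side involves the network only through the law of its count field.\<close>

lemma (in cellular_uplink) station_law:
  assumes J: "finite J" and A: "\<And>n. n \<in> J \<Longrightarrow> A n \<in> sets borel"
  shows "emeasure M {\<omega> \<in> space M. \<forall>n\<in>J. Y n \<omega> \<in> A n} =
    emeasure (distr M (Pi\<^sub>M bounded_borel (\<lambda>_. count_space UNIV)) (\<lambda>\<omega>. count_field (range (\<lambda>n. Y n \<omega>) - {0})))
      {f \<in> space (Pi\<^sub>M bounded_borel (\<lambda>_. count_space UNIV)).
        \<forall>n\<in>J. if n = 0 then 0 \<in> A 0 else nth_point_in n (A n) f}"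
proof -
  interpret P: homogeneous_ppp M lam "\<lambda>\<omega>. range (\<lambda>n. Y n \<omega>) - {0}" by (rule Y_poisson)
  let ?N = "\<lambda>\<omega>. count_field (range (\<lambda>n. Y n \<omega>) - {0})"
  let ?E = "{f \<in> space (Pi\<^sub>M bounded_borel (\<lambda>_. count_space UNIV)).
        \<forall>n\<in>J. if n = 0 then 0 \<in> A 0 else nth_point_in n (A n) f}"
  have [measurable]: "Measurable.pred (Pi\<^sub>M bounded_borel (\<lambda>_. count_space UNIV)) (nth_point_in n (A n))"
    if "n \<in> J" for n using nth_point_in_measurable[OF A[OF that]] .
  have E: "?E \<in> sets (Pi\<^sub>M bounded_borel (\<lambda>_. count_space UNIV))"
    unfolding pred_def[symmetric]
  proof (rule pred_intros_finite(3)[OF J])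
    fix n assume "n \<in> J"
    then show "Measurable.pred (Pi\<^sub>M bounded_borel (\<lambda>_. count_space UNIV))
        (\<lambda>f. if n = 0 then 0 \<in> A 0 else nth_point_in n (A n) f)"
      by measurable
  qed
  have [measurable]: "Y n \<in> borel_measurable M" for n by (rule Y_measurable)
  have "emeasure M {\<omega> \<in> space M. \<forall>n\<in>J. Y n \<omega> \<in> A n} = emeasure M (?N -` ?E \<inter> space M)"
  proof (rule emeasure_eq_AE)
    show "AE \<omega> in M. \<omega> \<in> {\<omega> \<in> space M. \<forall>n\<in>J. Y n \<omega> \<in> A n} \<longleftrightarrow> \<omega> \<in> ?N -` ?E \<inter> space M"
      using Y_ordered P.locally_finite AE_space
    proof eventually_elim
      case (elim \<omega>)
      have "(if n = 0 then 0 \<in> A 0 else nth_point_in n (A n) (?N \<omega>)) \<longleftrightarrow> Y n \<omega> \<in> A n" if "n \<in> J" for n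
        using nth_point_in_iff[of "\<lambda>n. Y n \<omega>" n "A n"] A[OF that] elim Y_origin[of \<omega>] by (cases n) auto
      then show ?case using elim measurable_space[OF P.count_field_measurable, of \<omega>] by auto
    qed
    show "{\<omega> \<in> space M. \<forall>n\<in>J. Y n \<omega> \<in> A n} \<in> sets M"
      using J A by measurable
    show "?N -` ?E \<inter> space M \<in> sets M" by (rule measurable_sets[OF P.count_field_measurable E])
  qed
  also have "\<dots> = emeasure (distr M (Pi\<^sub>M bounded_borel (\<lambda>_. count_space UNIV)) ?N) ?E"
    by (rule emeasure_distr[OF P.count_field_measurable E, symmetric])
  finally show ?thesis .
qed

lemma cellular_uplink_station_law_unique:
  assumes N: "cellular_uplink M lam Y U" and N': "cellular_uplink M' lam Y' U'"
  shows "distr M (Pi\<^sub>M UNIV (\<lambda>_. borel)) (\<lambda>\<omega> n. Y n \<omega>) = distr M' (Pi\<^sub>M UNIV (\<lambda>_. borel)) (\<lambda>\<omega> n. Y' n \<omega>)"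
proof -
  interpret N: cellular_uplink M lam Y U by fact
  interpret N': cellular_uplink M' lam Y' U' by fact
  show ?thesis
    by (rule distr_process_eqI)
      (simp_all add: N.prob_space_axioms N'.prob_space_axioms N.Y_measurable N'.Y_measurable N.station_law
        N'.station_law homogeneous_ppp_count_field_law_unique[OF N.Y_poisson N'.Y_poisson])
qed

section \<open>Sums over dyadic shells\<close>

definition shell :: "real \<Rightarrow> nat \<Rightarrow> 'a::euclidean_space set" where
  "shell \<rho> k = cball 0 (\<rho> * 2 ^ Suc k) - cball 0 (\<rho> * 2 ^ k)"

text \<open>An upper bound for the path loss from beyond \<rho> that depends on the configuration
  only through counts: each point is charged as if it lay on the inner boundary of its
  shell.\<close>

definition shell_sum :: "real \<Rightarrow> real \<Rightarrow> 'a::euclidean_space set \<Rightarrow> ennreal" where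
  "shell_sum \<alpha> \<rho> S = (\<Sum>k. of_nat (card (S \<inter> shell \<rho> k)) * ennreal ((\<rho> * 2 ^ k) powr (- \<alpha>)))"

lemma shell_bounded_borel: "shell \<rho> k \<in> sets borel" "bounded (shell \<rho> k)"
  by (auto simp: shell_def intro: bounded_subset[OF bounded_cball])

lemma ex_shell:
  fixes x :: "'a::euclidean_space"
  assumes "\<rho> > 0" "norm x > \<rho>"
  shows "\<exists>k. x \<in> shell \<rho> k"
proof -
  obtain m where "norm x / \<rho> < 2 ^ m" using real_arch_pow[of 2 "norm x / \<rho>"] by auto
  then have m: "norm x \<le> \<rho> * 2 ^ m" using assms by (simp add: field_simps)
  define k where "k = (LEAST k. norm x \<le> \<rho> * 2 ^ k)"
  have k: "norm x \<le> \<rho> * 2 ^ k" unfolding k_def using m by (rule LeastI)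
  have "k \<noteq> 0" using k assms by (intro notI) simp
  then obtain j where j: "k = Suc j" by (cases k) auto
  have "\<not> norm x \<le> \<rho> * 2 ^ j" using not_less_Least[of j "\<lambda>k. norm x \<le> \<rho> * 2 ^ k"] j by (simp add: k_def)
  then show ?thesis using k j by (intro exI[of _ j]) (simp add: shell_def)
qed

lemma sum_powr_le_shell_sum:
  fixes y :: "nat \<Rightarrow> 'a::euclidean_space"
  assumes \<rho>: "\<rho> > 0" and \<alpha>: "\<alpha> \<ge> 0" and inj: "inj y"
    and fin: "\<And>B. bounded B \<Longrightarrow> finite ((range y - {0}) \<inter> B)"
  shows "(\<Sum>n. ennreal (norm (y n) powr (- \<alpha>)) * indicator {x. norm x > \<rho>} (y n)) \<le>
    shell_sum \<alpha> \<rho> (range y - {0})"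
proof -
  let ?w = "\<lambda>k. ennreal ((\<rho> * 2 ^ k) powr (- \<alpha>))"
  have le: "ennreal (norm (y n) powr (- \<alpha>)) * indicator {x. norm x > \<rho>} (y n) \<le>
      (\<Sum>k. indicator (shell \<rho> k) (y n) * ?w k)" for n
  proof (cases "norm (y n) > \<rho>")
    case True
    then obtain k where k: "y n \<in> shell \<rho> k" using ex_shell[OF \<rho>] by blast
    define f where "f k = indicator (shell \<rho> k) (y n) * ?w k" for k
    have "norm (y n) powr (- \<alpha>) \<le> (\<rho> * 2 ^ k) powr (- \<alpha>)"
      using k \<rho> \<alpha> by (intro powr_mono2') (auto simp: shell_def)
    then have "ennreal (norm (y n) powr (- \<alpha>)) * indicator {x. norm x > \<rho>} (y n) \<le>
        f k"
      using k True by (simp add: f_def ennreal_leI)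
    also have "\<dots> \<le> (\<Sum>k. f k)" using sum_le_suminf[of f "{k}"] by simp
    finally show ?thesis unfolding f_def .
  qed simp
  have count: "(\<Sum>n. indicator (shell \<rho> k) (y n) :: ennreal) = of_nat (card ((range y - {0}) \<inter> shell \<rho> k))" for k
  proof -
    have im: "(range y - {0}) \<inter> shell \<rho> k = y ` {n. y n \<in> shell \<rho> k}" using \<rho> by (auto simp: shell_def)
    then have "finite (y ` {n. y n \<in> shell \<rho> k})" using fin[OF shell_bounded_borel(2)] by metis
    then have f: "finite {n. y n \<in> shell \<rho> k}" using finite_image_iff[OF inj_on_subset[OF inj subset_UNIV]] by blast
    have "(\<Sum>n. indicator (shell \<rho> k) (y n) :: ennreal) = (\<Sum>n. indicator {n. y n \<in> shell \<rho> k} n :: ennreal)"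
      by (intro suminf_cong) (simp add: indicator_def)
    also have "\<dots> = emeasure (count_space UNIV) {n. y n \<in> shell \<rho> k}"
      by (simp add: nn_integral_count_space_nat[symmetric])
    also have "\<dots> = of_nat (card ((range y - {0}) \<inter> shell \<rho> k))"
      unfolding im using f card_image[OF inj_on_subset[OF inj subset_UNIV]] by simp
    finally show ?thesis .
  qed
  have "(\<Sum>n. ennreal (norm (y n) powr (- \<alpha>)) * indicator {x. norm x > \<rho>} (y n)) \<le>
      (\<Sum>n. \<Sum>k. indicator (shell \<rho> k) (y n) * ?w k)"
    using le by (intro suminf_le) auto
  also have "\<dots> = (\<Sum>k. \<Sum>n. indicator (shell \<rho> k) (y n) * ?w k)"
    using nn_integral_suminf[of "\<lambda>k n. indicator (shell \<rho> k) (y n) * ?w k" "count_space UNIV"]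
    by (simp add: nn_integral_count_space_nat)
  also have "\<dots> = shell_sum \<alpha> \<rho> (range y - {0})"
    by (simp add: shell_sum_def count)
  finally show ?thesis .
qed

lemma (in homogeneous_ppp) shell_count_measurable [measurable]:
  "(\<lambda>\<omega>. card (\<Phi> \<omega> \<inter> shell \<rho> k)) \<in> measurable M (count_space UNIV)"
  "(\<lambda>\<omega>. card (\<Phi> \<omega> \<inter> cball 0 \<rho>)) \<in> measurable M (count_space UNIV)"
  by (intro count_measurable shell_bounded_borel; simp)+

lemma (in homogeneous_ppp) shell_sum_measurable [measurable]:
  "(\<lambda>\<omega>. shell_sum \<alpha> \<rho> (\<Phi> \<omega>)) \<in> borel_measurable M"
  unfolding shell_sum_def by measurable

lemma (in homogeneous_ppp) shell_sum_mean:
  "(\<integral>\<^sup>+\<omega>. shell_sum \<alpha> \<rho> (\<Phi> \<omega>) \<partial>M) =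
    (\<Sum>k. ennreal (lam * measure lborel (shell \<rho> k :: 'a set)) * ennreal ((\<rho> * 2 ^ k) powr (- \<alpha>)))"
  unfolding shell_sum_def
  by (subst nn_integral_suminf)
    (auto intro!: suminf_cong simp: nn_integral_multc count_mean[OF shell_bounded_borel])

text \<open>The expectation is taken term by term, so what is used is the independence of each
  single shell count from the void event. Every shell has inner radius at least \<rho> and is
  therefore disjoint from the ball.\<close>

lemma (in homogeneous_ppp) shell_sum_mean_void:
  assumes "\<rho> > 0"
  shows "(\<integral>\<^sup>+\<omega>. shell_sum \<alpha> \<rho> (\<Phi> \<omega>) * indicator {\<omega> \<in> space M. card (\<Phi> \<omega> \<inter> cball 0 \<rho>) = 0} \<omega> \<partial>M) =
    (\<integral>\<^sup>+\<omega>. shell_sum \<alpha> \<rho> (\<Phi> \<omega>) \<partial>M) * emeasure M {\<omega> \<in> space M. card (\<Phi> \<omega> \<inter> cball 0 \<rho>) = 0}"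
proof -
  let ?V = "{\<omega> \<in> space M. card (\<Phi> \<omega> \<inter> cball 0 \<rho>) = 0}" and ?w = "\<lambda>k. ennreal ((\<rho> * 2 ^ k) powr (- \<alpha>))"
  have "cball 0 \<rho> \<subseteq> (cball 0 (\<rho> * 2 ^ k) :: 'a set)" for k using assms by (intro subset_cball) simp
  then have disj: "shell \<rho> k \<inter> cball (0::'a) \<rho> = {}" for k by (auto simp only: shell_def)
  have "(0::'a) \<in> cball 0 \<rho>" using assms by simp
  then have neq: "shell \<rho> k \<noteq> cball (0::'a) \<rho>" for k using disj[of k] by blast
  have "(\<integral>\<^sup>+\<omega>. shell_sum \<alpha> \<rho> (\<Phi> \<omega>) * indicator ?V \<omega> \<partial>M) =
      (\<integral>\<^sup>+\<omega>. (\<Sum>k. ?w k * (of_nat (card (\<Phi> \<omega> \<inter> shell \<rho> k)) * indicator ?V \<omega>)) \<partial>M)"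
    unfolding shell_sum_def ennreal_suminf_multc[symmetric] by (simp add: mult.assoc mult.left_commute)
  also have "\<dots> = (\<Sum>k. ?w k * (\<integral>\<^sup>+\<omega>. of_nat (card (\<Phi> \<omega> \<inter> shell \<rho> k)) * indicator ?V \<omega> \<partial>M))"
    by (subst nn_integral_suminf) (auto intro!: suminf_cong nn_integral_cmult)
  also have "\<dots> = (\<Sum>k. ?w k * (ennreal (lam * measure lborel (shell \<rho> k :: 'a set)) * emeasure M ?V))"
    using count_mean_void[OF shell_bounded_borel _ _ disj neq] by (intro suminf_cong arg_cong2[where f = "(*)"]) auto
  also have "\<dots> = (\<integral>\<^sup>+\<omega>. shell_sum \<alpha> \<rho> (\<Phi> \<omega>) \<partial>M) * emeasure M ?V"
    unfolding shell_sum_mean ennreal_suminf_multc[symmetric] by (simp add: mult.assoc mult.left_commute)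
  finally show ?thesis .
qed

text \<open>With d the dimension, the k-th shell has volume at most a constant times
  \<open>(\<rho> * 2 ^ k) powr d\<close>, and each of its points is charged
  \<open>(\<rho> * 2 ^ k) powr (- \<alpha>)\<close>. The means are thus dominated by a geometric
  series of ratio \<open>2 powr (d - \<alpha>)\<close>, less than 1. Keeping the dependence on
  \<rho> explicit shows that the mean vanishes as \<rho> grows.\<close>

lemma (in homogeneous_ppp) shell_sum_mean_le:
  fixes \<alpha> :: real
  assumes \<alpha>: "\<alpha> > real DIM('a)"
  obtains D where "D > 0" "\<And>\<rho>. \<rho> > 0 \<Longrightarrow> (\<integral>\<^sup>+\<omega>. shell_sum \<alpha> \<rho> (\<Phi> \<omega>) \<partial>M) \<le> ennreal (D * \<rho> powr (DIM('a) - \<alpha>))"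
proof -
  let ?d = "real DIM('a)"
  define E where "E = lam * unit_ball_vol ?d * 2 powr ?d"
  define r where "r = 2 powr (?d - \<alpha>)"
  have r: "0 < r" "r < 1" using \<alpha> by (simp_all add: r_def powr_less_one)
  have E: "E > 0" using lam_pos by (simp add: E_def)
  have "(\<integral>\<^sup>+\<omega>. shell_sum \<alpha> \<rho> (\<Phi> \<omega>) \<partial>M) \<le> ennreal (E / (1 - r) * \<rho> powr (?d - \<alpha>))" if \<rho>: "\<rho> > 0" for \<rho>
  proof -
    have le: "lam * measure lborel (shell \<rho> k :: 'a set) * (\<rho> * 2 ^ k) powr (- \<alpha>) \<le> E * \<rho> powr (?d - \<alpha>) * r ^ k" for k
    proof -
      have "measure lborel (shell \<rho> k :: 'a set) \<le> measure lborel (cball 0 (\<rho> * 2 ^ Suc k) :: 'a set)"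
        by (intro measure_mono_fmeasurable fmeasurable_compact compact_cball) (auto simp: shell_def)
      also have "\<dots> = unit_ball_vol ?d * (\<rho> * 2 ^ Suc k) ^ DIM('a)"
        using \<rho> by (intro content_cball) simp
      also have "\<dots> = unit_ball_vol ?d * (2 powr ?d * (\<rho> * 2 ^ k) powr ?d)"
        using \<rho> by (simp add: powr_realpow power_mult_distrib)
      finally have "lam * measure lborel (shell \<rho> k :: 'a set) * (\<rho> * 2 ^ k) powr (- \<alpha>) \<le>
          lam * (unit_ball_vol ?d * (2 powr ?d * (\<rho> * 2 ^ k) powr ?d)) * (\<rho> * 2 ^ k) powr (- \<alpha>)"
        using lam_pos by (intro mult_right_mono mult_left_mono) auto
      also have "\<dots> = E * ((\<rho> * 2 ^ k) powr ?d * (\<rho> * 2 ^ k) powr (- \<alpha>))"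
        by (simp add: E_def)
      also have "\<dots> = E * (\<rho> * 2 ^ k) powr (?d - \<alpha>)" by (simp add: powr_add[symmetric])
      also have "(\<rho> * 2 ^ k) powr (?d - \<alpha>) = \<rho> powr (?d - \<alpha>) * r ^ k"
        using \<rho> by (simp add: powr_mult r_def powr_realpow[symmetric] powr_powr mult.commute)
      finally show ?thesis by simp
    qed
    have "(\<integral>\<^sup>+\<omega>. shell_sum \<alpha> \<rho> (\<Phi> \<omega>) \<partial>M) \<le> (\<Sum>k. ennreal (E * \<rho> powr (?d - \<alpha>) * r ^ k))"
      unfolding shell_sum_mean
      using le lam_pos by (intro suminf_le) (auto simp: ennreal_mult[symmetric] intro: ennreal_leI)
    also have "\<dots> = ennreal (E * \<rho> powr (?d - \<alpha>) * (1 / (1 - r)))"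
      using r E by (intro suminf_ennreal_eq sums_mult geometric_sums) auto
    finally show ?thesis by (simp add: mult_ac)
  qed
  moreover have "E / (1 - r) > 0" using E r by simp
  ultimately show ?thesis by (rule that[rotated])
qed

lemma (in homogeneous_ppp) shell_sum_finite:
  fixes \<alpha> :: real
  assumes "\<alpha> > real DIM('a)" "\<rho> > 0"
  shows "AE \<omega> in M. shell_sum \<alpha> \<rho> (\<Phi> \<omega>) < \<infinity>"
proof -
  obtain D where "(\<integral>\<^sup>+\<omega>. shell_sum \<alpha> \<rho> (\<Phi> \<omega>) \<partial>M) \<le> ennreal (D * \<rho> powr (DIM('a) - \<alpha>))"
    using shell_sum_mean_le[OF assms(1)] assms(2) by metis
  then have "(\<integral>\<^sup>+\<omega>. shell_sum \<alpha> \<rho> (\<Phi> \<omega>) \<partial>M) \<noteq> \<infinity>" by (auto simp: top_unique)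
  then have "AE \<omega> in M. shell_sum \<alpha> \<rho> (\<Phi> \<omega>) \<noteq> \<infinity>" by (intro nn_integral_noteq_infinite) auto
  then show ?thesis by (simp add: less_top)
qed

text \<open>Markov's inequality on the void event: \<rho> is taken so large that the mean of the
  shell sum, the same with or without the void, is below \<delta>. If the sum were almost surely at
  least \<delta> on that event, whose probability is positive for every \<rho>, its mean there would
  be at least \<delta>.\<close>

lemma (in homogeneous_ppp) void_small_shell_sum:
  fixes \<alpha> :: real
  assumes \<alpha>: "\<alpha> > real DIM('a)" and \<delta>: "\<delta> > 0" and R: "R > 0"
  obtains \<rho> where "\<rho> \<ge> R"
    "0 < emeasure M {\<omega> \<in> space M. card (\<Phi> \<omega> \<inter> cball 0 \<rho>) = 0 \<and> shell_sum \<alpha> \<rho> (\<Phi> \<omega>) < ennreal \<delta>}"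
proof -
  obtain D where D: "D > 0" "\<And>\<rho>. \<rho> > 0 \<Longrightarrow>
      (\<integral>\<^sup>+\<omega>. shell_sum \<alpha> \<rho> (\<Phi> \<omega>) \<partial>M) \<le> ennreal (D * \<rho> powr (DIM('a) - \<alpha>))"
    using shell_sum_mean_le[OF \<alpha>] by blast
  have "((\<lambda>\<rho>. D * \<rho> powr (DIM('a) - \<alpha>)) \<longlongrightarrow> D * 0) at_top"
    using \<alpha> by (intro tendsto_mult[OF tendsto_const tendsto_neg_powr[OF _ filterlim_ident]]) simp
  then have "eventually (\<lambda>\<rho>. D * \<rho> powr (DIM('a) - \<alpha>) < \<delta>) at_top"
    using \<delta> by (intro order_tendstoD(2)[of _ "D * 0"]) auto
  then have "eventually (\<lambda>\<rho>. D * \<rho> powr (DIM('a) - \<alpha>) < \<delta> \<and> \<rho> \<ge> R) at_top"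
    using eventually_ge_at_top[of R] by eventually_elim simp
  then obtain \<rho> where \<rho>: "D * \<rho> powr (DIM('a) - \<alpha>) < \<delta>" "\<rho> \<ge> R"
    using eventually_happens'[OF trivial_limit_at_top_linorder] by fast
  have \<rho>0: "\<rho> > 0" using \<rho> R by simp
  let ?V = "{\<omega> \<in> space M. card (\<Phi> \<omega> \<inter> cball 0 \<rho>) = 0}"
  let ?X = "\<lambda>\<omega>. shell_sum \<alpha> \<rho> (\<Phi> \<omega>)"
  let ?G = "{\<omega> \<in> space M. card (\<Phi> \<omega> \<inter> cball 0 \<rho>) = 0 \<and> ?X \<omega> < ennreal \<delta>}"
  have V: "emeasure M ?V > 0"
    using count_poisson[of "cball 0 \<rho>" 0] by (simp add: emeasure_eq_measure)
  have "emeasure M ?G > 0"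
  proof (rule ccontr)
    assume "\<not> 0 < emeasure M ?G"
    then have "AE \<omega> in M. \<omega> \<notin> ?G" by (intro AE_not_in null_setsI) (auto simp: zero_less_iff_neq_zero)
    then have "AE \<omega> in M. ennreal \<delta> * indicator ?V \<omega> \<le> ?X \<omega> * indicator ?V \<omega>"
      using AE_space by eventually_elim (auto simp: indicator_def)
    then have "(\<integral>\<^sup>+\<omega>. ennreal \<delta> * indicator ?V \<omega> \<partial>M) \<le> (\<integral>\<^sup>+\<omega>. ?X \<omega> * indicator ?V \<omega> \<partial>M)"
      by (rule nn_integral_mono_AE)
    then have "ennreal \<delta> * emeasure M ?V \<le> (\<integral>\<^sup>+\<omega>. ?X \<omega> \<partial>M) * emeasure M ?V"
      by (simp add: nn_integral_cmult_indicator shell_sum_mean_void[OF \<rho>0])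
    also have "\<dots> \<le> ennreal (D * \<rho> powr (DIM('a) - \<alpha>)) * emeasure M ?V"
      using D(2)[OF \<rho>0] by (rule mult_right_mono) simp
    finally have "ennreal (\<delta> * measure M ?V) \<le> ennreal (D * \<rho> powr (DIM('a) - \<alpha>) * measure M ?V)"
      using \<delta> D(1) by (simp add: emeasure_eq_measure ennreal_mult')
    then have "\<delta> * measure M ?V \<le> D * \<rho> powr (DIM('a) - \<alpha>) * measure M ?V"
      using D(1) by (subst (asm) ennreal_le_iff) simp_all
    then have "\<delta> \<le> D * \<rho> powr (DIM('a) - \<alpha>)"
      using V by (simp add: emeasure_eq_measure)
    then show False using \<rho>(1) by simp
  qed
  with \<rho> show ?thesis by (intro that)
qed

section \<open>Mobiles given the base stations\<close>

lemma closed_voronoi_cell: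
  fixes y :: "'a::metric_space"
  shows "closed (voronoi_cell S y)"
proof -
  have "voronoi_cell S y = (\<Inter>z\<in>S. {x. dist x y \<le> dist x z})" by (auto simp: voronoi_cell_def)
  then show ?thesis by (auto intro!: closed_INT closed_Collect_le continuous_intros)
qed

text \<open>Names the factors in the conditional axiom as functions of the station sequence. The
  value is 0 for every \<open>B\<close> when the cell has measure zero or infinity.\<close>

definition cell_law :: "(nat \<Rightarrow> 'a::euclidean_space) \<Rightarrow> nat \<Rightarrow> 'a set \<Rightarrow> real" where
  "cell_law y n B = measure (uniform_measure lborel (voronoi_cell (range y) (y n))) B"

lemma cell_law_eq:
  assumes "B \<in> sets borel"
  shows "cell_law y n B = enn2real (emeasure lborel (voronoi_cell (range y) (y n) \<inter> B) /
    emeasure lborel (voronoi_cell (range y) (y n)))"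
  using assms by (simp add: cell_law_def measure_def borel_closed closed_voronoi_cell)

text \<open>The cell is a section of a jointly measurable set, since it is cut out by countably many
  inequalities between distances; the measure of a section is measurable.\<close>

lemma measurable_cell_emeasure:
  fixes B :: "'a::euclidean_space set" and n :: nat
  assumes [measurable]: "B \<in> sets borel"
  shows "(\<lambda>y. emeasure lborel (voronoi_cell (range y) (y n) \<inter> B)) \<in> borel_measurable (Pi\<^sub>M UNIV (\<lambda>_. borel))"
proof -
  let ?P = "Pi\<^sub>M UNIV (\<lambda>_. borel) \<Otimes>\<^sub>M lborel"
  have [measurable]: "(\<lambda>x. fst x (m::nat)) \<in> borel_measurable ?P" for m
    by (rule measurable_compose[OF measurable_fst measurable_component_singleton]) simp
  have [measurable]: "(\<lambda>x. snd x) \<in> borel_measurable ?P"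
    by (rule measurable_compose[OF measurable_snd]) simp
  have "Measurable.pred ?P (\<lambda>x. (\<forall>m. dist (snd x) (fst x n) \<le> dist (snd x) (fst x m)) \<and> snd x \<in> B)"
    by measurable
  then show ?thesis
    by (intro lborel.measurable_emeasure) (auto simp: voronoi_cell_def pred_def)
qed

lemma cell_law_measurable:
  fixes B :: "'a::euclidean_space set" and n :: nat
  assumes B: "B \<in> sets borel"
  shows "(\<lambda>y. cell_law y n B) \<in> borel_measurable (Pi\<^sub>M UNIV (\<lambda>_. borel))"
proof -
  note [measurable] = measurable_cell_emeasure[OF B, of n] measurable_cell_emeasure[OF sets.top, of n, simplified]
  show ?thesis unfolding cell_law_eq[OF B] by measurable
qed

lemma cell_law_nonneg: "0 \<le> cell_law y n B"
  by (simp add: cell_law_def)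

lemma cell_law_le_1:
  assumes "B \<in> sets borel"
  shows "cell_law y n B \<le> 1"
proof -
  let ?C = "voronoi_cell (range y) (y n)"
  have "emeasure lborel (?C \<inter> B) \<le> emeasure lborel ?C"
    by (intro emeasure_mono) (auto simp: borel_closed closed_voronoi_cell)
  then have "emeasure lborel (?C \<inter> B) / emeasure lborel ?C \<le> 1"
    by (cases "emeasure lborel ?C = 0")
      (auto simp: divide_ennreal_def intro!: divide_le_posI_ennreal[unfolded divide_ennreal_def] simp: zero_less_iff_neq_zero)
  then show ?thesis unfolding cell_law_eq[OF assms] using enn2real_mono[of _ 1] by force
qed

lemma (in cellular_uplink) Y_process_measurable:
  "(\<lambda>\<omega> n. Y n \<omega>) \<in> measurable M (Pi\<^sub>M UNIV (\<lambda>_. borel))"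
  using Y_measurable by (auto intro!: measurable_PiM_single' simp: space_PiM)

lemma (in cellular_uplink) U_process_measurable:
  "(\<lambda>\<omega> n. U n \<omega>) \<in> measurable M (Pi\<^sub>M UNIV (\<lambda>_. borel))"
  using U_measurable by (auto intro!: measurable_PiM_single' simp: space_PiM)

text \<open>The conditional axiom in integrated form, by the defining property of conditional
  expectation on the event that the stations lie in \<open>A\<close>. Apart from scaling, everything
  about the mobiles is drawn from this identity.\<close>

lemma (in cellular_uplink) station_mobile_prob:
  assumes A: "A \<in> sets (Pi\<^sub>M UNIV (\<lambda>_. borel))" and J: "finite J" "\<And>n. n \<in> J \<Longrightarrow> B n \<in> sets borel"
  shows "prob {\<omega> \<in> space M. (\<lambda>n. Y n \<omega>) \<in> A \<and> (\<forall>n\<in>J. U n \<omega> \<in> B n)} =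
    (\<integral>\<omega>. indicator A (\<lambda>n. Y n \<omega>) * (\<Prod>n\<in>J. cell_law (\<lambda>m. Y m \<omega>) n (B n)) \<partial>M)"
proof -
  let ?F = "vimage_algebra (space M) (\<lambda>\<omega> n. Y n \<omega>) (Pi\<^sub>M UNIV (\<lambda>_. borel))"
  let ?E = "{\<omega> \<in> space M. \<forall>n\<in>J. U n \<omega> \<in> B n}" and ?A = "(\<lambda>\<omega> n. Y n \<omega>) -` A \<inter> space M"
  have [measurable]: "U n \<in> borel_measurable M" for n by (rule U_measurable)
  have E[measurable]: "?E \<in> sets M" using J by measurable
  have "subalgebra M ?F"
    using sets_image_in_sets[OF refl Y_process_measurable] by (simp add: subalgebra_def)
  then interpret F: finite_measure_subalgebra M ?F by unfold_locales
  have AF: "?A \<in> sets ?F" using A by (rule in_vimage_algebra)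
  then have A_M[measurable]: "?A \<in> sets M" using F.subalg by (auto simp: subalgebra_def)
  have "prob {\<omega> \<in> space M. (\<lambda>n. Y n \<omega>) \<in> A \<and> (\<forall>n\<in>J. U n \<omega> \<in> B n)} = prob (?A \<inter> ?E)"
    by (rule arg_cong[where f = prob]) auto
  also have "\<dots> = (\<integral>\<omega>\<in>?A. indicator ?E \<omega> \<partial>M)"
    by (simp add: set_lebesgue_integral_def indicator_inter_arith[symmetric] Int_absorb2 del: vimage_Int)
  also have "\<dots> = (\<integral>\<omega>\<in>?A. real_cond_exp M ?F (indicator ?E) \<omega> \<partial>M)"
    by (rule F.real_cond_exp_intA[OF _ AF]) (auto intro!: integrable_real_indicator simp: less_top[symmetric])
  also have "\<dots> = (\<integral>\<omega>. indicator A (\<lambda>n. Y n \<omega>) * (\<Prod>n\<in>J. cell_law (\<lambda>m. Y m \<omega>) n (B n)) \<partial>M)"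
    unfolding set_lebesgue_integral_def
  proof (rule integral_cong_AE)
    have [measurable]: "(\<lambda>\<omega>. cell_law (\<lambda>m. Y m \<omega>) n (B n)) \<in> borel_measurable M" if "n \<in> J" for n
      using measurable_compose[OF Y_process_measurable cell_law_measurable[OF J(2)[OF that]]] .
    have [measurable]: "(\<lambda>\<omega>. indicator A (\<lambda>n. Y n \<omega>) :: real) \<in> borel_measurable M"
      using measurable_compose[OF Y_process_measurable borel_measurable_indicator[OF A]] .
    show "(\<lambda>\<omega>. indicator A (\<lambda>n. Y n \<omega>) * (\<Prod>n\<in>J. cell_law (\<lambda>m. Y m \<omega>) n (B n))) \<in> borel_measurable M"
      by measurable
    show "(\<lambda>\<omega>. indicator ?A \<omega> *\<^sub>R real_cond_exp M ?F (indicator ?E) \<omega>) \<in> borel_measurable M"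
      by measurable
    have "AE \<omega> in M. real_cond_exp M ?F (indicator ?E) \<omega> = (\<Prod>n\<in>J. cell_law (\<lambda>m. Y m \<omega>) n (B n))"
      unfolding cell_law_def by (rule U_cond_indep_uniform) (use J in auto)
    then show "AE \<omega> in M. indicator ?A \<omega> *\<^sub>R real_cond_exp M ?F (indicator ?E) \<omega> =
        indicator A (\<lambda>n. Y n \<omega>) * (\<Prod>n\<in>J. cell_law (\<lambda>m. Y m \<omega>) n (B n))"
      using AE_space by eventually_elim (simp add: indicator_def)
  qed
  finally show ?thesis .
qed

text \<open>The finite-dimensional probabilities of the mobiles are integrals of one fixed function
  of the station sequence, whose law is already determined.\<close>

lemma cellular_uplink_mobile_law_unique:
  assumes N: "cellular_uplink M lam Y U" and N': "cellular_uplink M' lam Y' U'"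
  shows "distr M (Pi\<^sub>M UNIV (\<lambda>_. borel)) (\<lambda>\<omega> n. U n \<omega>) = distr M' (Pi\<^sub>M UNIV (\<lambda>_. borel)) (\<lambda>\<omega> n. U' n \<omega>)"
proof -
  interpret N: cellular_uplink M lam Y U by fact
  interpret N': cellular_uplink M' lam Y' U' by fact
  show ?thesis
  proof (rule distr_process_eqI)
    fix J and B :: "nat \<Rightarrow> (real^2) set" assume J: "finite J" "\<And>n. n \<in> J \<Longrightarrow> B n \<in> sets borel"
    let ?h = "\<lambda>y. \<Prod>n\<in>J. cell_law y n (B n)"
    have h: "?h \<in> borel_measurable (Pi\<^sub>M UNIV (\<lambda>_. borel))"
      using J by (intro borel_measurable_prod cell_law_measurable) auto
    have "N.prob {\<omega> \<in> space M. \<forall>n\<in>J. U n \<omega> \<in> B n} = (\<integral>y. ?h y \<partial>distr M (Pi\<^sub>M UNIV (\<lambda>_. borel)) (\<lambda>\<omega> n. Y n \<omega>))"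
      using N.station_mobile_prob[OF sets.top J]
      by (simp add: space_PiM integral_distr[OF N.Y_process_measurable h])
    moreover have "N'.prob {\<omega> \<in> space M'. \<forall>n\<in>J. U' n \<omega> \<in> B n} =
        (\<integral>y. ?h y \<partial>distr M' (Pi\<^sub>M UNIV (\<lambda>_. borel)) (\<lambda>\<omega> n. Y' n \<omega>))"
      using N'.station_mobile_prob[OF sets.top J]
      by (simp add: space_PiM integral_distr[OF N'.Y_process_measurable h])
    ultimately show "emeasure M {\<omega> \<in> space M. \<forall>n\<in>J. U n \<omega> \<in> B n} = emeasure M' {\<omega> \<in> space M'. \<forall>n\<in>J. U' n \<omega> \<in> B n}"
      by (simp add: N.emeasure_eq_measure N'.emeasure_eq_measure cellular_uplink_station_law_unique[OF N N'])
  qed (simp_all add: N.prob_space_axioms N'.prob_space_axioms N.U_measurable N'.U_measurable)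
qed

section \<open>Scaling\<close>

text \<open>Counts are indexed by the sets themselves, so passing to the preimages under a dilation
  renames the indices of an independent family.\<close>

lemma (in prob_space) indep_sets_reindex:
  assumes inj: "inj_on f I" and indep: "indep_sets F (f ` I)"
  shows "indep_sets (\<lambda>i. F (f i)) I"
  unfolding indep_sets_def
proof (intro conjI ballI allI impI)
  show "F (f i) \<subseteq> events" if "i \<in> I" for i using indep that by (auto simp: indep_sets_def)
  fix J A assume J: "J \<subseteq> I" "J \<noteq> {}" "finite J" and A: "A \<in> Pi J (\<lambda>i. F (f i))"
  define A' where "A' k = A (the_inv_into J f k)" for k
  have inj_J: "inj_on f J" using inj J(1) by (rule inj_on_subset)
  then have A'[simp]: "A' (f j) = A j" if "j \<in> J" for j using that by (simp add: A'_def the_inv_into_f_f)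
  have "prob (\<Inter>k\<in>f ` J. A' k) = (\<Prod>k\<in>f ` J. prob (A' k))"
  proof -
    have "f ` J \<subseteq> f ` I" "f ` J \<noteq> {}" "finite (f ` J)" "A' \<in> Pi (f ` J) F"
      using J A by auto
    moreover from indep have "\<forall>K\<subseteq>f ` I. K \<noteq> {} \<longrightarrow> finite K \<longrightarrow>
        (\<forall>A\<in>Pi K F. prob (\<Inter>k\<in>K. A k) = (\<Prod>k\<in>K. prob (A k)))"
      unfolding indep_sets_def by (rule conjunct2)
    ultimately show ?thesis by (simp only: simp_thms)
  qed
  then show "prob (\<Inter>j\<in>J. A j) = (\<Prod>j\<in>J. prob (A j))"
    by (simp add: prod.reindex[OF inj_J])
qed

lemma (in prob_space) indep_vars_reindex:
  assumes "inj_on f I" "indep_vars M' X (f ` I)"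
  shows "indep_vars (\<lambda>i. M' (f i)) (\<lambda>i. X (f i)) I"
  using assms(2) indep_sets_reindex[OF assms(1)] unfolding indep_vars_def2 by auto

lemma emeasure_lborel_scaled_vimage:
  fixes B :: "'a::euclidean_space set"
  assumes "c > 0" "B \<in> sets borel"
  shows "emeasure lborel B = ennreal (c ^ DIM('a)) * emeasure lborel ((\<lambda>x. c *\<^sub>R x) -` B)"
proof -
  have "emeasure lborel B = emeasure (density (distr lborel borel (\<lambda>x. 0 + c *\<^sub>R x)) (\<lambda>_. \<bar>c\<bar>^DIM('a))) B"
    using lborel_affine[of c "0::'a"] assms by simp
  also have "\<dots> = ennreal (c ^ DIM('a)) * emeasure lborel ((\<lambda>x. c *\<^sub>R x) -` B)"
    using assms by (simp add: emeasure_density_const emeasure_distr)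
  finally show ?thesis .
qed

lemma measure_lborel_scaled_vimage:
  fixes B :: "'a::euclidean_space set"
  assumes "c > 0" "B \<in> sets borel"
  shows "measure lborel ((\<lambda>x. c *\<^sub>R x) -` B) = measure lborel B / c ^ DIM('a)"
  using assms emeasure_lborel_scaled_vimage[OF assms]
  by (simp add: measure_def enn2real_mult)

lemma scaled_vimage_borel:
  fixes B :: "'a::euclidean_space set"
  assumes "B \<in> sets borel"
  shows "(\<lambda>x. c *\<^sub>R x) -` B \<in> sets borel"
  using measurable_sets[of "\<lambda>x. c *\<^sub>R x" borel borel B] assms by simp

lemma voronoi_cell_scaled:
  fixes y :: "'a::real_normed_vector"
  assumes "c > 0"
  shows "(\<lambda>x. c *\<^sub>R x) -` voronoi_cell ((\<lambda>x. c *\<^sub>R x) ` S) (c *\<^sub>R y) = voronoi_cell S y"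
proof -
  have "dist (c *\<^sub>R a) (c *\<^sub>R b) = c * dist a b" for a b :: 'a
    using assms by (simp add: dist_norm scaleR_diff_right[symmetric])
  then show ?thesis using assms by (auto simp: voronoi_cell_def)
qed

text \<open>Cells are equivariant under dilation, and the Jacobian factor \<open>c ^ DIM('a)\<close>
  cancels in the quotient of the two volumes.\<close>

lemma cell_law_scaled:
  fixes B :: "'a::euclidean_space set"
  assumes c: "c > 0" and B: "B \<in> sets borel"
  shows "cell_law (\<lambda>m. c *\<^sub>R y m) n B = cell_law y n ((\<lambda>x. c *\<^sub>R x) -` B)"
proof -
  let ?C = "voronoi_cell (range (\<lambda>m. c *\<^sub>R y m)) (c *\<^sub>R y n)"
  note vB = scaled_vimage_borel[OF B, of c]
  have C: "(\<lambda>x. c *\<^sub>R x) -` ?C = voronoi_cell (range y) (y n)"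
    using voronoi_cell_scaled[OF c, of "range y" "y n"] by (simp add: image_image)
  have "emeasure lborel (?C \<inter> B) / emeasure lborel ?C =
      emeasure lborel (voronoi_cell (range y) (y n) \<inter> (\<lambda>x. c *\<^sub>R x) -` B) /
      emeasure lborel (voronoi_cell (range y) (y n))"
    using c B emeasure_lborel_scaled_vimage[OF c, of ?C] emeasure_lborel_scaled_vimage[OF c, of "?C \<inter> B"]
    by (simp add: C borel_closed closed_voronoi_cell mult.commute[of "ennreal (c ^ DIM('a))"] divide_mult_eq)
  then show ?thesis unfolding cell_law_eq[OF B] cell_law_eq[OF vB] by simp
qed

lemma (in homogeneous_ppp) scaled:
  assumes c: "c > 0"
  shows "homogeneous_ppp M (lam / c ^ DIM('a)) (\<lambda>\<omega>. (\<lambda>x. c *\<^sub>R x) ` \<Phi> \<omega>)"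
proof -
  let ?v = "\<lambda>B::'a set. (\<lambda>x. c *\<^sub>R x) -` B"
  have inj: "inj (\<lambda>x::'a. c *\<^sub>R x)" using c by (simp add: inj_def)
  have img: "(\<lambda>x. c *\<^sub>R x) ` S \<inter> B = (\<lambda>x. c *\<^sub>R x) ` (S \<inter> ?v B)" for S B by auto
  have card: "card ((\<lambda>x. c *\<^sub>R x) ` S \<inter> B) = card (S \<inter> ?v B)" for S B
    unfolding img by (rule card_image[OF inj_on_subset[OF inj subset_UNIV]])
  have v_eq: "?v B = (\<lambda>x. (1 / c) *\<^sub>R x) ` B" for B
  proof
    show "?v B \<subseteq> (\<lambda>x. (1 / c) *\<^sub>R x) ` B"
    proof
      fix x assume "x \<in> ?v B"
      then show "x \<in> (\<lambda>x. (1 / c) *\<^sub>R x) ` B"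
        using c by (intro image_eqI[of _ _ "c *\<^sub>R x"]) simp_all
    qed
  qed (use c in auto)
  have bdd: "bounded (?v B)" if "bounded B" for B
    unfolding v_eq using that by (rule bounded_scaling)
  note borel = scaled_vimage_borel[of _ c]
  show ?thesis
  proof
    show "lam / c ^ DIM('a) > 0" using lam_pos c by simp
    show "AE \<omega> in M. \<forall>B. bounded B \<longrightarrow> finite ((\<lambda>x. c *\<^sub>R x) ` \<Phi> \<omega> \<inter> B)"
      using locally_finite by eventually_elim (simp add: img bdd)
    show "prob {\<omega> \<in> space M. card ((\<lambda>x. c *\<^sub>R x) ` \<Phi> \<omega> \<inter> B) = k} =
        (lam / c ^ DIM('a) * measure lborel B) ^ k / fact k * exp (- (lam / c ^ DIM('a) * measure lborel B))"
      if "B \<in> sets borel" "bounded B" for B k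
      unfolding card using count_poisson[OF borel bdd, OF that] that
      by (simp add: measure_lborel_scaled_vimage[OF c])
    show "indep_vars (\<lambda>_. count_space UNIV) (\<lambda>B \<omega>. card ((\<lambda>x. c *\<^sub>R x) ` \<Phi> \<omega> \<inter> B)) \<B>"
      if \<B>: "finite \<B>" "disjoint \<B>" "\<And>B. B \<in> \<B> \<Longrightarrow> B \<in> sets borel \<and> bounded B" for \<B>
      unfolding card
    proof (rule indep_vars_reindex[where f = ?v])
      show "inj_on ?v \<B>"
      proof (rule inj_onI)
        fix A B assume "?v A = ?v B"
        then have "(\<lambda>x. c *\<^sub>R x) ` ?v A = (\<lambda>x. c *\<^sub>R x) ` ?v B" by simp
        moreover have "(\<lambda>x. c *\<^sub>R x) ` ?v D = D" for D using c unfolding v_eq by (simp add: image_image)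
        ultimately show "A = B" by simp
      qed
      show "indep_vars (\<lambda>_. count_space UNIV) (\<lambda>B \<omega>. card (\<Phi> \<omega> \<inter> B)) (?v ` \<B>)"
      proof (rule count_indep)
        show "disjoint (?v ` \<B>)"
          unfolding disjoint_def
        proof (intro ballI impI)
          fix A' B' assume "A' \<in> ?v ` \<B>" "B' \<in> ?v ` \<B>" "A' \<noteq> B'"
          then obtain A B where AB: "A' = ?v A" "B' = ?v B" "A \<in> \<B>" "B \<in> \<B>" "A \<noteq> B" by blast
          then have "A \<inter> B = {}" using \<B>(2) by (auto simp: disjoint_def)
          then show "A' \<inter> B' = {}" unfolding AB by blast
        qed
        show "B' \<in> sets borel \<and> bounded B'" if "B' \<in> ?v ` \<B>" for B'
          using that \<B>(3) borel bdd by blast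
      qed (use \<B> in simp)
    qed
  qed
qed

lemma (in cellular_uplink) scaled:
  assumes c: "c > 0"
  shows "cellular_uplink M (lam / c\<^sup>2) (\<lambda>n \<omega>. c *\<^sub>R Y n \<omega>) (\<lambda>n \<omega>. c *\<^sub>R U n \<omega>)"
proof (intro cellular_uplink.intro cellular_uplink_axioms.intro)
  show "prob_space M" by (rule prob_space_axioms)
  have [measurable]: "Y n \<in> borel_measurable M" "U n \<in> borel_measurable M" for n
    by (rule Y_measurable U_measurable)+
  show "(\<lambda>\<omega>. c *\<^sub>R Y n \<omega>) \<in> borel_measurable M" "(\<lambda>\<omega>. c *\<^sub>R U n \<omega>) \<in> borel_measurable M" for n
    by measurable
  show "c *\<^sub>R Y 0 \<omega> = 0" if "\<omega> \<in> space M" for \<omega> using Y_origin[OF that] by simp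
  show "AE \<omega> in M. strict_mono (\<lambda>n. norm (c *\<^sub>R Y n \<omega>))"
    using Y_ordered c by (simp add: strict_mono_def)
  have "(\<lambda>\<omega>. range (\<lambda>n. c *\<^sub>R Y n \<omega>) - {0}) = (\<lambda>\<omega>. (\<lambda>x. c *\<^sub>R x) ` (range (\<lambda>n. Y n \<omega>) - {0}))"
  proof
    fix \<omega>
    have "inj (\<lambda>x :: real^2. c *\<^sub>R x)" using c by (simp add: inj_def)
    from image_set_diff[OF this, of "range (\<lambda>n. Y n \<omega>)" "{0}"]
    show "range (\<lambda>n. c *\<^sub>R Y n \<omega>) - {0} = (\<lambda>x. c *\<^sub>R x) ` (range (\<lambda>n. Y n \<omega>) - {0})"
      by (simp add: image_image)
  qed
  then show "homogeneous_ppp M (lam / c\<^sup>2) (\<lambda>\<omega>. range (\<lambda>n. c *\<^sub>R Y n \<omega>) - {0})"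
    using homogeneous_ppp.scaled[OF Y_poisson c] by simp
  let ?F = "\<lambda>Y. vimage_algebra (space M) (\<lambda>\<omega> n. Y n \<omega>) (Pi\<^sub>M UNIV (\<lambda>_. borel))"
  have scale: "(\<lambda>y n. a *\<^sub>R y n) \<in> measurable (Pi\<^sub>M UNIV (\<lambda>_. borel)) (Pi\<^sub>M (UNIV :: nat set) (\<lambda>_. borel :: (real^2) measure))" for a
    by (auto intro!: measurable_PiM_single' borel_measurable_scaleR measurable_component_singleton simp: space_PiM)
  have sub: "sets (?F (\<lambda>n \<omega>. a *\<^sub>R Z n \<omega>)) \<subseteq> sets (?F Z)" for a and Z :: "nat \<Rightarrow> 'w \<Rightarrow> real^2"
    by (rule sets_image_in_sets) (auto intro!: measurable_compose[OF measurable_vimage_algebra1 scale] simp: space_PiM)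
  \<comment> \<open>A dilation is invertible, so conditioning on the scaled stations is conditioning
    on the original ones; the reverse inclusion is \<open>sub\<close> with factor 1 / c.\<close>
  have sets_F: "sets (?F (\<lambda>n \<omega>. c *\<^sub>R Y n \<omega>)) = sets (?F Y)"
  proof (rule equalityI[OF sub])
    show "sets (?F Y) \<subseteq> sets (?F (\<lambda>n \<omega>. c *\<^sub>R Y n \<omega>))"
      using sub[of "1 / c" "\<lambda>n \<omega>. c *\<^sub>R Y n \<omega>"] c by simp
  qed
  \<comment> \<open>Rewriting inside \<open>real_cond_exp\<close> needs equal measures, not only
    equal sigma-algebras.\<close>
  have F: "?F (\<lambda>n \<omega>. c *\<^sub>R Y n \<omega>) = ?F Y"
    unfolding vimage_algebra_def by (rule sigma_eqI[OF _ _ sets_F[unfolded sets_vimage_algebra]]) auto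
  fix J and B :: "nat \<Rightarrow> (real^2) set" assume J: "finite J" and B: "\<And>n. n \<in> J \<Longrightarrow> B n \<in> sets borel"
  have "AE \<omega> in M. real_cond_exp M (?F Y) (indicator {\<omega> \<in> space M. \<forall>n\<in>J. U n \<omega> \<in> (\<lambda>x. c *\<^sub>R x) -` B n}) \<omega> =
        (\<Prod>n\<in>J. cell_law (\<lambda>m. Y m \<omega>) n ((\<lambda>x. c *\<^sub>R x) -` B n))"
    unfolding cell_law_def
    by (rule U_cond_indep_uniform[OF J]) (rule scaled_vimage_borel[OF B])
  moreover have "(\<Prod>n\<in>J. cell_law (\<lambda>m. Y m \<omega>) n ((\<lambda>x. c *\<^sub>R x) -` B n)) =
      (\<Prod>n\<in>J. measure (uniform_measure lborel (voronoi_cell (range (\<lambda>m. c *\<^sub>R Y m \<omega>)) (c *\<^sub>R Y n \<omega>))) (B n))" for \<omega>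
  proof (intro prod.cong refl)
    fix n assume "n \<in> J"
    from cell_law_scaled[OF c B[OF this], of "\<lambda>m. Y m \<omega>" n]
    show "cell_law (\<lambda>m. Y m \<omega>) n ((\<lambda>x. c *\<^sub>R x) -` B n) =
        measure (uniform_measure lborel (voronoi_cell (range (\<lambda>m. c *\<^sub>R Y m \<omega>)) (c *\<^sub>R Y n \<omega>))) (B n)"
      by (simp add: cell_law_def)
  qed
  ultimately show "AE \<omega> in M. real_cond_exp M (?F (\<lambda>n \<omega>. c *\<^sub>R Y n \<omega>))
      (indicator {\<omega> \<in> space M. \<forall>n\<in>J. c *\<^sub>R U n \<omega> \<in> B n}) \<omega> =
      (\<Prod>n\<in>J. measure (uniform_measure lborel (voronoi_cell (range (\<lambda>m. c *\<^sub>R Y m \<omega>)) (c *\<^sub>R Y n \<omega>))) (B n))"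
    by (simp add: F)
qed

section \<open>Outage as a function of the mobile locations\<close>

text \<open>Valid also in the divergent case, where both defaults are 0: \<open>infsum\<close> of a
  family that is not summable, and \<open>enn2real top\<close>. The interference is thereby
  measurable on all configurations, without a summability condition.\<close>

lemma infsum_eq_enn2real_suminf:
  fixes f :: "nat \<Rightarrow> real"
  assumes f: "\<And>n. 0 \<le> f n"
  shows "infsum f A = enn2real (\<Sum>n. ennreal (f n) * indicator A n)"
proof -
  define g where "g n = f n * indicator A n" for n
  have g: "0 \<le> g n" for n using f by (simp add: g_def)
  have eq: "(\<Sum>n. ennreal (f n) * indicator A n) = (\<Sum>n. ennreal (g n))"
    unfolding g_def by (intro suminf_cong) (simp split: split_indicator)
  have infsum: "infsum f A = infsum g UNIV"
    unfolding g_def by (intro infsum_cong_neutral) auto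
  show ?thesis
  proof (cases "summable g")
    case True
    have "(g has_sum suminf g) UNIV"
      by (rule norm_summable_imp_has_sum[OF _ summable_sums[OF True]]) (simp add: g True)
    then have "infsum g UNIV = suminf g" by (rule infsumI)
    moreover have "(\<Sum>n. ennreal (g n)) = ennreal (suminf g)" by (rule suminf_ennreal2[OF g True])
    ultimately show ?thesis
      unfolding eq infsum using suminf_nonneg[OF True g] by (simp only: enn2real_ennreal)
  next
    case False
    then have "\<not> g summable_on UNIV" by (subst summable_on_UNIV_nonneg_real_iff[OF g])
    then have "infsum g UNIV = 0" by (rule infsum_not_exists)
    moreover have "(\<Sum>n. ennreal (g n)) = top"
      using False summable_suminf_not_top[OF g] by (rule contrapos_np)
    ultimately show ?thesis unfolding eq infsum by (simp only: enn2real_top)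
  qed
qed

lemma closer_interferers_scaled: "c > 0 \<Longrightarrow> closer_interferers (\<lambda>n. c *\<^sub>R u n) = closer_interferers u"
  by (simp add: closer_interferers_def fun_eq_iff)

lemma cancelled_scaled: "c > 0 \<Longrightarrow> cancelled K (\<lambda>n. c *\<^sub>R u n) = cancelled K u"
  by (simp add: cancelled_def closer_interferers_scaled)

lemma interference_eq_mult: "interference \<alpha> p K u = p * interference \<alpha> 1 K u"
  by (simp add: interference_def infsum_cmult_right')

lemma interference_scaled:
  assumes "c > 0"
  shows "interference \<alpha> p K (\<lambda>n. c *\<^sub>R u n) = interference \<alpha> (p * c powr (- \<alpha>)) K u"
  using assms by (simp add: interference_def cancelled_scaled powr_mult mult.assoc)

lemma interference_nonneg: "p \<ge> 0 \<Longrightarrow> 0 \<le> interference \<alpha> p K u"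
  by (auto simp: interference_def intro!: infsum_nonneg)

text \<open>Dilating all locations attenuates every received power by the same factor, which is as
  good as lowering the transmission power; the set of cancelled mobiles depends only on the order of
  the distances and does not change.\<close>

lemma outage_prob_scaled:
  assumes "c > 0"
  shows "outage_prob M (\<lambda>n \<omega>. c *\<^sub>R U n \<omega>) \<alpha> \<theta> \<sigma> K p = outage_prob M U \<alpha> \<theta> \<sigma> K (p * c powr (- \<alpha>))"
  using assms by (simp add: outage_prob_def interference_scaled powr_mult mult.assoc)

section \<open>Measurability and outage as functionals of the mobile law\<close>

lemma closer_measurable:
  fixes f :: "nat \<Rightarrow> 'x \<Rightarrow> real"
  assumes [measurable]: "\<And>m. f m \<in> borel_measurable M"
  shows "Measurable.pred M (\<lambda>x. f m x < f n x \<or> f m x = f n x \<and> m < n)"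
  by measurable

lemma component_measurable:
  "(\<lambda>u. u m) \<in> borel_measurable (Pi\<^sub>M (UNIV :: nat set) (\<lambda>_. borel :: 'a::topological_space measure))"
  by (rule measurable_component_singleton) simp

lemma cancelled_measurable:
  "Measurable.pred (Pi\<^sub>M UNIV (\<lambda>_. borel :: (real^2) measure)) (\<lambda>u. n \<in> cancelled K u)"
proof -
  have "(\<lambda>u. norm (u m)) \<in> borel_measurable (Pi\<^sub>M (UNIV :: nat set) (\<lambda>_. borel :: (real^2) measure))" for m
    by (rule measurable_compose[OF component_measurable borel_measurable_norm])
  from closer_measurable[of "\<lambda>m u. norm (u m)", OF this]
  have "Measurable.pred (Pi\<^sub>M UNIV (\<lambda>_. borel)) (\<lambda>u :: nat \<Rightarrow> real^2.
      m \<noteq> 0 \<and> (norm (u m) < norm (u n) \<or> norm (u m) = norm (u n) \<and> m < n))" for m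
    by (cases "m = 0") simp_all
  then have closer: "{u \<in> space (Pi\<^sub>M UNIV (\<lambda>_. borel)). m \<in> closer_interferers u n} \<in>
      sets (Pi\<^sub>M UNIV (\<lambda>_. borel :: (real^2) measure))" for m
    unfolding closer_interferers_def mem_Collect_eq pred_def .
  note [measurable] = measurable_finite[OF closer] measurable_card[OF closer]
  show ?thesis unfolding cancelled_def mem_Collect_eq by measurable
qed

lemma interference_measurable:
  "interference \<alpha> p K \<in> borel_measurable (Pi\<^sub>M UNIV (\<lambda>_. borel :: (real^2) measure))"
proof -
  note [measurable] = component_measurable
  note [measurable] = cancelled_measurable
  have "interference \<alpha> p K u = p * enn2real (\<Sum>n. if n = 0 \<or> n \<in> cancelled K u then 0
      else ennreal (norm (u n) powr (- \<alpha>)))" for u :: "nat \<Rightarrow> real^2"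
  proof -
    have "ennreal (norm (u n) powr (- \<alpha>)) * indicator (- ({0} \<union> cancelled K u)) n =
        (if n = 0 \<or> n \<in> cancelled K u then 0 else ennreal (norm (u n) powr (- \<alpha>)))" for n
      by simp
    then show ?thesis
      unfolding interference_def infsum_cmult_right' by (subst infsum_eq_enn2real_suminf) simp_all
  qed
  then have "interference \<alpha> p K = (\<lambda>u :: nat \<Rightarrow> real^2. p * enn2real (\<Sum>n. if n = 0 \<or> n \<in> cancelled K u then 0
      else ennreal (norm (u n) powr (- \<alpha>))))" by (rule ext)
  also have "\<dots> \<in> borel_measurable (Pi\<^sub>M UNIV (\<lambda>_. borel))"
    by measurable
  finally show ?thesis .
qed

lemma outage_set_measurable:
  "{u \<in> space (Pi\<^sub>M UNIV (\<lambda>_. borel :: (real^2) measure)).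
     p * norm (u 0) powr (- \<alpha>) / (interference \<alpha> p K u + \<sigma>\<^sup>2) < \<theta>} \<in> sets (Pi\<^sub>M UNIV (\<lambda>_. borel))"
proof -
  note [measurable] = component_measurable
  note [measurable] = interference_measurable
  show ?thesis by measurable
qed

lemma (in cellular_uplink) outage_prob_eq_law:
  "outage_prob M U \<alpha> \<theta> \<sigma> K p = measure (distr M (Pi\<^sub>M UNIV (\<lambda>_. borel)) (\<lambda>\<omega> n. U n \<omega>))
     {u \<in> space (Pi\<^sub>M UNIV (\<lambda>_. borel)). p * norm (u 0) powr (- \<alpha>) / (interference \<alpha> p K u + \<sigma>\<^sup>2) < \<theta>}"
  by (subst measure_distr[OF U_process_measurable outage_set_measurable])
    (auto simp: outage_prob_def space_PiM intro!: arg_cong[where f = prob])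

lemma outage_prob_density:
  assumes N: "cellular_uplink M lam Y U" and N1: "cellular_uplink M1 1 Y1 U1"
  shows "outage_prob M U \<alpha> \<theta> \<sigma> K p = outage_prob M1 U1 \<alpha> \<theta> \<sigma> K (p * lam powr (\<alpha> / 2))"
proof -
  interpret N: cellular_uplink M lam Y U by fact
  have lam: "lam > 0" using N.Y_poisson by (simp add: homogeneous_ppp_def homogeneous_ppp_axioms_def)
  define c where "c = sqrt lam"
  have c: "c > 0" "lam / c\<^sup>2 = 1" using lam by (simp_all add: c_def)
  have cp: "c powr \<alpha> = lam powr (\<alpha> / 2)" using lam by (simp add: c_def powr_half_sqrt[symmetric] powr_powr)
  have N': "cellular_uplink M 1 (\<lambda>n \<omega>. c *\<^sub>R Y n \<omega>) (\<lambda>n \<omega>. c *\<^sub>R U n \<omega>)"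
    using N.scaled[OF c(1)] c(2) by simp
  \<comment> \<open>The raised power compensates exactly for the attenuation
    \<open>c powr (- \<alpha>)\<close> caused by the dilation.\<close>
  have "outage_prob M U \<alpha> \<theta> \<sigma> K p = outage_prob M (\<lambda>n \<omega>. c *\<^sub>R U n \<omega>) \<alpha> \<theta> \<sigma> K (p * c powr \<alpha>)"
    unfolding outage_prob_scaled[OF c(1)] using c(1) by (simp add: mult.assoc powr_add[symmetric])
  also have "\<dots> = outage_prob M1 U1 \<alpha> \<theta> \<sigma> K (p * c powr \<alpha>)"
    unfolding cellular_uplink.outage_prob_eq_law[OF N'] cellular_uplink.outage_prob_eq_law[OF N1]
      cellular_uplink_mobile_law_unique[OF N' N1] ..
  finally show ?thesis by (simp add: cp)
qed

section \<open>Configurations without nearby base stations\<close>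

text \<open>Only finitely many points lie in the ball of radius \<rho>, each with a finite term; the
  shells control the others.\<close>

lemma sum_powr_finite:
  fixes y :: "nat \<Rightarrow> 'a::euclidean_space"
  assumes \<rho>: "\<rho> > 0" and \<alpha>: "\<alpha> \<ge> 0" and inj: "inj y"
    and fin: "\<And>B. bounded B \<Longrightarrow> finite ((range y - {0}) \<inter> B)"
    and shells: "shell_sum \<alpha> \<rho> (range y - {0}) < \<infinity>"
  shows "(\<Sum>n. ennreal (norm (y n) powr (- \<alpha>))) < \<infinity>"
proof -
  let ?f = "\<lambda>n. ennreal (norm (y n) powr (- \<alpha>))"
  let ?N = "{n. y n \<in> cball 0 \<rho>}"
  have "y ` ?N \<subseteq> insert 0 ((range y - {0}) \<inter> cball 0 \<rho>)" by auto
  then have "finite (y ` ?N)" using fin[OF bounded_cball] by (meson finite.insertI finite_subset)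
  then have N: "finite ?N" using finite_image_iff[OF inj_on_subset[OF inj subset_UNIV]] by blast
  have "(\<Sum>n. ?f n) = (\<Sum>n. ?f n * indicator {x. norm x > \<rho>} (y n) + ?f n * indicator ?N n)"
    by (intro suminf_cong) (simp split: split_indicator)
  also have "\<dots> = (\<Sum>n. ?f n * indicator {x. norm x > \<rho>} (y n)) + (\<Sum>n. ?f n * indicator ?N n)"
    by (intro suminf_add[symmetric]) auto
  also have "(\<Sum>n. ?f n * indicator ?N n) = (\<Sum>n\<in>?N. ?f n * indicator ?N n)"
    using N by (intro suminf_finite) auto
  also have "\<dots> = ennreal (\<Sum>n\<in>?N. norm (y n) powr (- \<alpha>))" by (simp add: sum_ennreal)
  finally show ?thesis
    using le_less_trans[OF sum_powr_le_shell_sum[OF \<rho> \<alpha> inj fin] shells] by (simp add: less_top)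
qed

text \<open>The base station at the origin contributes \<open>0 powr (- \<alpha>) = 0\<close>.\<close>

definition path_loss :: "real \<Rightarrow> (nat \<Rightarrow> real^2) \<Rightarrow> ennreal" where
  "path_loss \<alpha> y = (\<Sum>n. ennreal (norm (y n) powr (- \<alpha>)))"

text \<open>The factor \<open>2 powr \<alpha>\<close> is the price of a mobile being up to twice as
  close to the origin as its station. The bound is uniform in the set \<open>C\<close> of cancelled
  labels, so it serves every \<open>K\<close>.\<close>

lemma interferers_path_loss_le:
  assumes \<alpha>: "\<alpha> \<ge> 0" and y: "inj y" "y 0 = 0" and le: "\<forall>n. norm (y n) \<le> 2 * norm (u n)"
  shows "(\<Sum>n. ennreal (norm (u n) powr (- \<alpha>)) * indicator (- ({0} \<union> C)) n) \<le>
    ennreal (2 powr \<alpha>) * path_loss \<alpha> y"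
proof -
  have "ennreal (norm (u n) powr (- \<alpha>)) * indicator (- ({0} \<union> C)) n \<le>
      ennreal (2 powr \<alpha>) * ennreal (norm (y n) powr (- \<alpha>))" for n
  proof (cases "n = 0")
    case False
    then have yn: "norm (y n) > 0" using inj_eq[OF y(1), of n 0] y(2) by simp
    then have "norm (u n) powr (- \<alpha>) \<le> (norm (y n) / 2) powr (- \<alpha>)"
      using le[rule_format, of n] \<alpha> by (intro powr_mono2') auto
    also have "\<dots> = 2 powr \<alpha> * norm (y n) powr (- \<alpha>)"
      using yn by (simp add: powr_divide powr_minus field_simps)
    finally have "ennreal (norm (u n) powr (- \<alpha>)) \<le> ennreal (2 powr \<alpha> * norm (y n) powr (- \<alpha>))"
      by (rule ennreal_leI)
    then show ?thesis by (simp add: ennreal_mult' split: split_indicator)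
  qed simp
  then have "(\<Sum>n. ennreal (norm (u n) powr (- \<alpha>)) * indicator (- ({0} \<union> C)) n) \<le>
      (\<Sum>n. ennreal (2 powr \<alpha>) * ennreal (norm (y n) powr (- \<alpha>)))"
    by (intro suminf_le) auto
  then show ?thesis by (simp add: path_loss_def)
qed

text \<open>A condition on the station sequence alone, in the form of a measurable set, so that it
  can take the place of \<open>A\<close> in \<open>station_mobile_prob\<close>.\<close>

definition remote_stations :: "real \<Rightarrow> real \<Rightarrow> real \<Rightarrow> (nat \<Rightarrow> real^2) set" where
  "remote_stations \<alpha> R \<delta> = {y \<in> space (Pi\<^sub>M UNIV (\<lambda>_. borel)). (\<forall>n>0. norm (y n) > R) \<and> path_loss \<alpha> y < ennreal \<delta>}"

lemma remote_stations_measurable: "remote_stations \<alpha> R \<delta> \<in> sets (Pi\<^sub>M UNIV (\<lambda>_. borel))"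
proof -
  have [measurable]: "(\<lambda>y. norm (y n)) \<in> borel_measurable (Pi\<^sub>M (UNIV::nat set) (\<lambda>_. borel :: (real^2) measure))" for n
    by (rule measurable_compose[OF component_measurable borel_measurable_norm])
  show ?thesis unfolding remote_stations_def path_loss_def by measurable
qed

context cellular_uplink
begin

lemma station_sample:
  "AE \<omega> in M. Y 0 \<omega> = 0 \<and> inj (\<lambda>n. Y n \<omega>) \<and>
    (\<forall>B. bounded B \<longrightarrow> finite ((range (\<lambda>n. Y n \<omega>) - {0}) \<inter> B))"
  using Y_ordered homogeneous_ppp.locally_finite[OF Y_poisson] AE_space
proof eventually_elim
  case (elim \<omega>)
  have "inj (\<lambda>n. Y n \<omega>)"
  proof (rule injI)
    fix m n assume "Y m \<omega> = Y n \<omega>"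
    then show "m = n" using strict_mono_eq[OF elim(1), of m n] by simp
  qed
  then show ?case using elim Y_origin by blast
qed

text \<open>The axiom with \<open>B = UNIV\<close> gives this variable mean 1, and it never exceeds
  1. This shows without any geometry that the cell of the origin almost surely has positive and
  finite area.\<close>

lemma cell_law_origin_UNIV: "AE \<omega> in M. cell_law (\<lambda>m. Y m \<omega>) 0 UNIV = 1"
proof -
  let ?c = "\<lambda>\<omega>. cell_law (\<lambda>m. Y m \<omega>) 0 UNIV"
  have m[measurable]: "?c \<in> borel_measurable M"
    using measurable_compose[OF Y_process_measurable cell_law_measurable[OF sets.top]] by simp
  have le: "?c \<omega> \<le> 1" for \<omega> by (rule cell_law_le_1) simp
  have int: "integrable M ?c"
    by (rule integrable_const_bound[where B = 1]) (auto simp: cell_law_nonneg le)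
  have "(\<integral>\<omega>. ?c \<omega> \<partial>M) = 1"
    using station_mobile_prob[OF sets.top, of "{0}" "\<lambda>_. UNIV"] by (simp add: space_PiM prob_space)
  then have "(\<integral>\<omega>. 1 - ?c \<omega> \<partial>M) = 0" using int by (simp add: prob_space)
  then have "AE \<omega> in M. 1 - ?c \<omega> = 0"
    using int le by (subst (asm) integral_nonneg_eq_0_iff_AE) auto
  then show ?thesis by eventually_elim simp
qed

text \<open>The origin is a station, so a point of the cell of \<open>Y n\<close> is at least as
  close to \<open>Y n\<close> as to 0, and the triangle inequality gives the factor 2. The
  conditional axiom treats fixed Borel sets only; a rational threshold between the two random norms
  reduces the claim to countably many null events.\<close>

lemma mobile_norm_ge: "AE \<omega> in M. \<forall>n. norm (Y n \<omega>) \<le> 2 * norm (U n \<omega>)"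
proof -
  have null: "AE \<omega> in M. \<not> (norm (Y n \<omega>) > 2 * of_rat q \<and> norm (U n \<omega>) \<le> of_rat q)" for n and q :: rat
  proof -
    define A where "A = {y \<in> space (Pi\<^sub>M (UNIV::nat set) (\<lambda>_. borel :: (real^2) measure)). norm (y n) > 2 * of_rat q}"
    have A: "A \<in> sets (Pi\<^sub>M UNIV (\<lambda>_. borel))"
      unfolding A_def using measurable_compose[OF component_measurable borel_measurable_norm] by measurable
    have zero: "indicator A (\<lambda>m. Y m \<omega>) * cell_law (\<lambda>m. Y m \<omega>) n (cball 0 (of_rat q)) = 0"
      if "\<omega> \<in> space M" for \<omega>
    proof (cases "(\<lambda>m. Y m \<omega>) \<in> A")
      case True
      have "x \<notin> cball 0 (of_rat q)" if "x \<in> voronoi_cell (range (\<lambda>m. Y m \<omega>)) (Y n \<omega>)" for x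
      proof -
        have "dist x (Y n \<omega>) \<le> dist x (Y 0 \<omega>)" using that by (auto simp: voronoi_cell_def)
        moreover have "norm (Y n \<omega>) \<le> dist x (Y n \<omega>) + norm x"
          using norm_triangle_ineq[of "Y n \<omega> - x" x] by (simp add: dist_norm norm_minus_commute)
        ultimately show ?thesis using True Y_origin[OF \<open>\<omega> \<in> space M\<close>] by (simp add: A_def)
      qed
      then have "voronoi_cell (range (\<lambda>m. Y m \<omega>)) (Y n \<omega>) \<inter> cball 0 (of_rat q) = {}" by blast
      then show ?thesis by (simp add: cell_law_eq)
    qed simp
    have "prob {\<omega> \<in> space M. (\<lambda>m. Y m \<omega>) \<in> A \<and> (\<forall>k\<in>{n}. U k \<omega> \<in> cball 0 (of_rat q))} =
      (\<integral>\<omega>. indicator A (\<lambda>m. Y m \<omega>) * (\<Prod>k\<in>{n}. cell_law (\<lambda>m. Y m \<omega>) k (cball 0 (of_rat q))) \<partial>M)"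
      by (rule station_mobile_prob[OF A]) auto
    also have "\<dots> = (\<integral>\<omega>. 0 \<partial>M)" using zero by (intro Bochner_Integration.integral_cong) auto
    finally have "prob {\<omega> \<in> space M. norm (Y n \<omega>) > 2 * of_rat q \<and> norm (U n \<omega>) \<le> of_rat q} = 0"
      by (simp add: A_def space_PiM)
    moreover have "{\<omega> \<in> space M. norm (Y n \<omega>) > 2 * of_rat q \<and> norm (U n \<omega>) \<le> of_rat q} \<in> sets M"
      using Y_measurable[of n] U_measurable[of n] by measurable
    ultimately show ?thesis
      by (subst AE_iff_measurable[OF _ refl]) (auto simp: emeasure_eq_measure)
  qed
  then have "AE \<omega> in M. \<forall>n. \<forall>q::rat. \<not> (norm (Y n \<omega>) > 2 * of_rat q \<and> norm (U n \<omega>) \<le> of_rat q)"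
    by (simp add: AE_all_countable)
  then show ?thesis
  proof eventually_elim
    case (elim \<omega>)
    show ?case
    proof (intro allI, rule ccontr)
      fix n assume "\<not> norm (Y n \<omega>) \<le> 2 * norm (U n \<omega>)"
      then have "norm (U n \<omega>) < norm (Y n \<omega>) / 2" by simp
      from of_rat_dense[OF this] obtain q :: rat
        where "norm (U n \<omega>) < of_rat q" "of_rat q < norm (Y n \<omega>) / 2" by blast
      then show False using elim[rule_format, of q n] by simp
    qed
  qed
qed

lemma path_loss_finite:
  assumes "\<alpha> > 2"
  shows "AE \<omega> in M. path_loss \<alpha> (\<lambda>n. Y n \<omega>) < \<infinity>"
proof -
  interpret P: homogeneous_ppp M lam "\<lambda>\<omega>. range (\<lambda>n. Y n \<omega>) - {0}" by (rule Y_poisson)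
  have "AE \<omega> in M. shell_sum \<alpha> 1 (range (\<lambda>n. Y n \<omega>) - {0}) < \<infinity>"
    using assms by (intro P.shell_sum_finite) simp_all
  with station_sample show ?thesis
    unfolding path_loss_def
    by eventually_elim (rule sum_powr_finite[of 1], use assms in auto)
qed

lemma remote_stations_prob:
  assumes "\<alpha> > 2" "\<delta> > 0" "R > 0"
  shows "prob {\<omega> \<in> space M. (\<lambda>n. Y n \<omega>) \<in> remote_stations \<alpha> R \<delta>} > 0"
proof -
  interpret P: homogeneous_ppp M lam "\<lambda>\<omega>. range (\<lambda>n. Y n \<omega>) - {0}" by (rule Y_poisson)
  let ?S = "\<lambda>\<omega>. range (\<lambda>n. Y n \<omega>) - {0}"
  obtain \<rho> where \<rho>: "\<rho> \<ge> R" and pos: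
    "0 < emeasure M {\<omega> \<in> space M. card (?S \<omega> \<inter> cball 0 \<rho>) = 0 \<and> shell_sum \<alpha> \<rho> (?S \<omega>) < ennreal \<delta>}"
    using P.void_small_shell_sum[of \<alpha> \<delta> R] assms by auto
  have E: "{\<omega> \<in> space M. (\<lambda>n. Y n \<omega>) \<in> remote_stations \<alpha> R \<delta>} \<in> sets M"
    using measurable_sets[OF Y_process_measurable remote_stations_measurable] by (simp add: vimage_def Int_def conj_commute)
  have "emeasure M {\<omega> \<in> space M. card (?S \<omega> \<inter> cball 0 \<rho>) = 0 \<and> shell_sum \<alpha> \<rho> (?S \<omega>) < ennreal \<delta>} \<le>
      emeasure M {\<omega> \<in> space M. (\<lambda>n. Y n \<omega>) \<in> remote_stations \<alpha> R \<delta>}"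
  proof (rule emeasure_mono_AE[OF _ E])
    show "AE \<omega> in M. \<omega> \<in> {\<omega> \<in> space M. card (?S \<omega> \<inter> cball 0 \<rho>) = 0 \<and> shell_sum \<alpha> \<rho> (?S \<omega>) < ennreal \<delta>} \<longrightarrow>
        \<omega> \<in> {\<omega> \<in> space M. (\<lambda>n. Y n \<omega>) \<in> remote_stations \<alpha> R \<delta>}"
      using station_sample
    proof (eventually_elim, safe)
      fix \<omega> assume \<omega>: "\<omega> \<in> space M" and Y: "Y 0 \<omega> = 0" "inj (\<lambda>n. Y n \<omega>)"
        and fin: "\<forall>B. bounded B \<longrightarrow> finite (?S \<omega> \<inter> B)"
        and void: "card (?S \<omega> \<inter> cball 0 \<rho>) = 0" and small: "shell_sum \<alpha> \<rho> (?S \<omega>) < ennreal \<delta>"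
      \<comment> \<open>A zero \<open>card\<close> means emptiness only because the set is known to
        be finite.\<close>
      have "?S \<omega> \<inter> cball 0 \<rho> = {}" using void fin bounded_cball by (metis card_0_eq)
      then have "(\<lambda>n. Y n \<omega>) ` {0<..} \<inter> cball 0 \<rho> = {}" unfolding range_minus_origin[OF Y(2,1)] .
      then have far: "norm (Y n \<omega>) > \<rho>" if "n > 0" for n using that by (force simp: disjoint_iff)
      \<comment> \<open>At n = 0 the indicator is 0, but so is the left-hand side, as
        \<open>0 powr (- \<alpha>) = 0\<close>.\<close>
      have "ennreal (norm (Y n \<omega>) powr (- \<alpha>)) = ennreal (norm (Y n \<omega>) powr (- \<alpha>)) * indicator {x. norm x > \<rho>} (Y n \<omega>)" for n
        using far[of n] Y(1) by (cases "n = 0") simp_all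
      then have "path_loss \<alpha> (\<lambda>n. Y n \<omega>) =
          (\<Sum>n. ennreal (norm (Y n \<omega>) powr (- \<alpha>)) * indicator {x. norm x > \<rho>} (Y n \<omega>))"
        unfolding path_loss_def by (rule suminf_cong)
      also have "\<dots> \<le> shell_sum \<alpha> \<rho> (?S \<omega>)"
        using assms \<rho> Y fin by (intro sum_powr_le_shell_sum) auto
      finally have "path_loss \<alpha> (\<lambda>n. Y n \<omega>) < ennreal \<delta>" using small by (rule le_less_trans)
      moreover have "norm (Y n \<omega>) > R" if "n > 0" for n using far[OF that] \<rho> by simp
      ultimately show "(\<lambda>n. Y n \<omega>) \<in> remote_stations \<alpha> R \<delta>"
        by (simp add: remote_stations_def space_PiM)
    qed
  qed
  then show ?thesis using pos by (simp add: emeasure_eq_measure)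
qed

text \<open>If every other station is farther than 2 * b, then all points of norm below b are
  nearest to the origin. The cell of the origin contains the annulus, which has positive area, so
  the conditional probability that the mobile falls into it is positive.\<close>

lemma origin_mobile_in_annulus:
  assumes "\<alpha> > 2" "\<delta> > 0" "0 < a" "a < b"
  shows "prob {\<omega> \<in> space M. (\<lambda>n. Y n \<omega>) \<in> remote_stations \<alpha> (2 * b) \<delta> \<and> a < norm (U 0 \<omega>) \<and> norm (U 0 \<omega>) < b} > 0"
proof -
  define B where "B = {x :: real^2. a < norm x \<and> norm x < b}"
  let ?A = "remote_stations \<alpha> (2 * b) \<delta>"
  let ?f = "\<lambda>\<omega>. indicator ?A (\<lambda>n. Y n \<omega>) * cell_law (\<lambda>m. Y m \<omega>) 0 B"
  have B_open: "open B" unfolding B_def by (intro open_Collect_conj open_Collect_less continuous_intros)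
  then have B: "B \<in> sets borel" by simp
  have prob_eq: "prob {\<omega> \<in> space M. (\<lambda>n. Y n \<omega>) \<in> ?A \<and> a < norm (U 0 \<omega>) \<and> norm (U 0 \<omega>) < b} = (\<integral>\<omega>. ?f \<omega> \<partial>M)"
    using station_mobile_prob[OF remote_stations_measurable[of \<alpha> "2 * b" \<delta>], of "{0}" "\<lambda>_. B"] B
    by (simp add: B_def)
  have "(\<lambda>\<omega>. cell_law (\<lambda>m. Y m \<omega>) 0 B) \<in> borel_measurable M"
    "(\<lambda>\<omega>. indicator ?A (\<lambda>n. Y n \<omega>) :: real) \<in> borel_measurable M"
    using measurable_compose[OF Y_process_measurable cell_law_measurable[OF B]]
      measurable_compose[OF Y_process_measurable borel_measurable_indicator[OF remote_stations_measurable]] by auto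
  then have f: "?f \<in> borel_measurable M" by simp
  have int: "integrable M ?f"
    by (rule integrable_const_bound[where B = 1, OF _ f])
      (auto simp: cell_law_nonneg cell_law_le_1[OF B] split: split_indicator)
  obtain x where "norm x = (a + b) / 2" "x \<in> B"
    using vector_choose_size[of "(a + b) / 2"] assms by (auto simp: B_def)
  then obtain r where r: "r > 0" "ball x r \<subseteq> B" using B_open openE by blast
  have "0 < emeasure lborel (ball x r)" using content_ball_pos[OF r(1), of x] by (simp add: measure_def enn2real_positive_iff)
  also have "\<dots> \<le> emeasure lborel B" using r(2) B by (intro emeasure_mono) auto
  finally have B_pos: "emeasure lborel B > 0" .
  have pos: "AE \<omega> in M. (\<lambda>n. Y n \<omega>) \<in> ?A \<longrightarrow> cell_law (\<lambda>m. Y m \<omega>) 0 B > 0"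
    using cell_law_origin_UNIV AE_space
  proof eventually_elim
    case (elim \<omega>)
    let ?C = "voronoi_cell (range (\<lambda>m. Y m \<omega>)) (Y 0 \<omega>)"
    show ?case
    proof
      assume A: "(\<lambda>n. Y n \<omega>) \<in> ?A"
      have "B \<subseteq> ?C"
      proof
        fix z assume z: "z \<in> B"
        have "dist z (Y 0 \<omega>) \<le> dist z (Y m \<omega>)" for m
        proof (cases "m = 0")
          case False
          then have "norm (Y m \<omega>) > 2 * b" using A by (simp add: remote_stations_def)
          moreover have "norm (Y m \<omega>) \<le> dist z (Y m \<omega>) + norm z"
            using norm_triangle_ineq[of "Y m \<omega> - z" z] by (simp add: dist_norm norm_minus_commute)
          ultimately show ?thesis using z Y_origin[OF elim(2)] by (simp add: B_def)
        qed simp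
        then show "z \<in> ?C" by (auto simp: voronoi_cell_def)
      qed
      then have CB: "?C \<inter> B = B" by blast
      \<comment> \<open>The quotient would be 0 for a cell of measure zero or infinity, so its being
        1 rules out both.\<close>
      have one: "enn2real (emeasure lborel ?C / emeasure lborel ?C) = 1"
        using elim(1) by (simp add: cell_law_eq)
      have C: "emeasure lborel ?C \<noteq> 0" "emeasure lborel ?C \<noteq> \<infinity>"
        using one by (intro notI; simp)+
      have "emeasure lborel B \<le> emeasure lborel ?C"
        using \<open>B \<subseteq> ?C\<close> by (intro emeasure_mono) (auto simp: borel_closed closed_voronoi_cell)
      then have "measure lborel B > 0" "measure lborel ?C > 0"
        using B_pos C by (auto simp: measure_def enn2real_positive_iff less_top[symmetric] top_unique zero_less_iff_neq_zero)
      then show "cell_law (\<lambda>m. Y m \<omega>) 0 B > 0"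
        using measure_uniform_measure[OF C, of B] B by (simp add: cell_law_def CB)
    qed
  qed
  \<comment> \<open>The integrand is nonnegative and almost surely positive on the remote event; a
    zero integral would make that event null.\<close>
  have "(\<integral>\<omega>. ?f \<omega> \<partial>M) \<noteq> 0"
  proof
    assume "(\<integral>\<omega>. ?f \<omega> \<partial>M) = 0"
    then have "AE \<omega> in M. ?f \<omega> = 0"
      using int by (subst (asm) integral_nonneg_eq_0_iff_AE) (auto simp: cell_law_nonneg)
    with pos have "AE \<omega> in M. \<not> (\<lambda>n. Y n \<omega>) \<in> ?A"
      by eventually_elim (auto split: split_indicator)
    then have "prob {\<omega> \<in> space M. (\<lambda>n. Y n \<omega>) \<in> ?A} = 0"
      by (intro measure_eq_AE[where B = "{}", simplified] prob_eq_0_AE)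
    then show False using remote_stations_prob[of \<alpha> \<delta> "2 * b"] assms by simp
  qed
  moreover have "0 \<le> (\<integral>\<omega>. ?f \<omega> \<partial>M)" by (intro integral_nonneg_AE) (auto simp: cell_law_nonneg)
  ultimately show ?thesis unfolding prob_eq by simp
qed

end

section \<open>Excess interference\<close>

definition excess :: "real \<Rightarrow> real \<Rightarrow> nat \<Rightarrow> (nat \<Rightarrow> real^2) \<Rightarrow> real" where
  "excess \<alpha> \<theta> K u = interference \<alpha> 1 K u - inverse \<theta> * norm (u 0) powr (- \<alpha>)"

lemma excess_measurable: "excess \<alpha> \<theta> K \<in> borel_measurable (Pi\<^sub>M UNIV (\<lambda>_. borel))"
proof -
  have [measurable]: "(\<lambda>u. norm (u 0)) \<in> borel_measurable (Pi\<^sub>M (UNIV::nat set) (\<lambda>_. borel :: (real^2) measure))"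
    by (rule measurable_compose[OF component_measurable borel_measurable_norm])
  note [measurable] = interference_measurable
  show ?thesis unfolding excess_def[abs_def] by measurable
qed

lemma outage_iff_excess:
  assumes "q > 0" "\<theta> > 0" "\<sigma>\<^sup>2 > 0"
  shows "q * norm (u 0) powr (- \<alpha>) / (interference \<alpha> q K u + \<sigma>\<^sup>2) < \<theta> \<longleftrightarrow> excess \<alpha> \<theta> K u + \<sigma>\<^sup>2 / q > 0"
proof -
  have I: "interference \<alpha> 1 K u \<ge> 0" by (rule interference_nonneg) simp
  have eq: "interference \<alpha> q K u = q * interference \<alpha> 1 K u" by (rule interference_eq_mult)
  have "q * interference \<alpha> 1 K u + \<sigma>\<^sup>2 > 0" using I assms by (simp add: add_nonneg_pos)
  then have "q * norm (u 0) powr (- \<alpha>) / (interference \<alpha> q K u + \<sigma>\<^sup>2) < \<theta> \<longleftrightarrow>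
      q * norm (u 0) powr (- \<alpha>) < \<theta> * (q * interference \<alpha> 1 K u + \<sigma>\<^sup>2)"
    unfolding eq by (simp add: pos_divide_less_eq)
  also have "\<dots> \<longleftrightarrow> 0 < \<theta> * (q * interference \<alpha> 1 K u + \<sigma>\<^sup>2) - q * norm (u 0) powr (- \<alpha>)"
    by simp
  also have "\<theta> * (q * interference \<alpha> 1 K u + \<sigma>\<^sup>2) - q * norm (u 0) powr (- \<alpha>) =
      (q * \<theta>) * (excess \<alpha> \<theta> K u + \<sigma>\<^sup>2 / q)"
    using assms by (simp add: excess_def field_simps)
  also have "0 < (q * \<theta>) * (excess \<alpha> \<theta> K u + \<sigma>\<^sup>2 / q) \<longleftrightarrow> excess \<alpha> \<theta> K u + \<sigma>\<^sup>2 / q > 0"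
    using mult_pos_pos[OF assms(1,2)] zero_less_mult_pos mult_pos_pos by blast
  finally show ?thesis .
qed

text \<open>Finiteness is essential: for a divergent interference the single series on the left
  defaults to 0 as a whole, whereas in \<open>excess\<close> only the interference part does and the
  signal term survives.\<close>

lemma infsum_eq_excess:
  assumes fin: "(\<Sum>n. ennreal (norm (u n) powr (- \<alpha>)) * indicator (- ({0} \<union> cancelled K u)) n) < \<infinity>"
  shows "(\<Sum>\<^sub>\<infinity>n. norm (u n) powr (- \<alpha>) * of_bool (n \<notin> {0} \<union> cancelled K u)
      - inverse \<theta> * norm (u 0) powr (- \<alpha>) * of_bool (n = 0)) = excess \<alpha> \<theta> K u"
proof -
  let ?f = "\<lambda>n. norm (u n) powr (- \<alpha>) * of_bool (n \<notin> {0} \<union> cancelled K u)"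
  let ?g = "\<lambda>n. - (inverse \<theta> * norm (u 0) powr (- \<alpha>)) * of_bool (n = (0::nat))"
  have "(\<Sum>n. ennreal (?f n)) = (\<Sum>n. ennreal (norm (u n) powr (- \<alpha>)) * indicator (- ({0} \<union> cancelled K u)) n)"
    by (intro suminf_cong) (simp split: split_indicator)
  then have "summable ?f" using fin by (intro summable_suminf_not_top) auto
  then have f: "?f summable_on UNIV" by (subst summable_on_UNIV_nonneg_real_iff) auto
  have g: "?g summable_on UNIV" "infsum ?g UNIV = - (inverse \<theta> * norm (u 0) powr (- \<alpha>))"
    using has_sum_finite_neutralI[of "{0}" UNIV ?g] by (auto simp: summable_on_def infsumI)
  have "infsum (\<lambda>n. ?f n - inverse \<theta> * norm (u 0) powr (- \<alpha>) * of_bool (n = 0)) UNIV =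
      infsum (\<lambda>n. ?f n + ?g n) UNIV" by (intro infsum_cong) simp
  also have "\<dots> = infsum ?f UNIV + infsum ?g UNIV" by (rule infsum_add[OF f g(1)])
  also have "infsum ?f UNIV = interference \<alpha> 1 K u"
    unfolding interference_def by (intro infsum_cong_neutral) auto
  finally show ?thesis unfolding g(2) excess_def by simp
qed

context cellular_uplink
begin

lemma excess_random_variable: "(\<lambda>\<omega>. excess \<alpha> \<theta> K (\<lambda>n. U n \<omega>)) \<in> borel_measurable M"
  by (rule measurable_compose[OF U_process_measurable excess_measurable])

lemma excess_charges_intervals:
  assumes \<alpha>: "\<alpha> > 2" and \<theta>: "\<theta> > 0" and \<mu>: "0 < \<mu>" "\<mu> < s"
  shows "prob {\<omega> \<in> space M. - s < excess \<alpha> \<theta> K (\<lambda>n. U n \<omega>) \<and> excess \<alpha> \<theta> K (\<lambda>n. U n \<omega>) \<le> - \<mu>} > 0"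
proof -
  \<comment> \<open>The signal term is to lie between \<mu> + \<delta> and \<mu> + 2 * \<delta>, and
    the interference in [0, \<delta>). Their difference then stays below - \<mu> and above - (\<mu>
    + 2 * \<delta>) > - s.\<close>
  define \<delta> where "\<delta> = (s - \<mu>) / 3"
  have \<delta>: "\<delta> > 0" "\<mu> + 2 * \<delta> < s" using \<mu> by (simp_all add: \<delta>_def field_simps)
  \<comment> \<open>The radii at which the signal term equals \<mu> + 2 * \<delta> and \<mu> +
    \<delta>; the larger value belongs to the smaller radius.\<close>
  define a where "a = (\<theta> * (\<mu> + 2 * \<delta>)) powr (- 1 / \<alpha>)"
  define b where "b = (\<theta> * (\<mu> + \<delta>)) powr (- 1 / \<alpha>)"
  have ab: "0 < a" "a < b"
    using \<alpha> \<theta> \<mu> \<delta> by (auto simp: a_def b_def intro!: powr_less_mono2_neg)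
  have a': "a powr (- \<alpha>) = \<theta> * (\<mu> + 2 * \<delta>)" and b': "b powr (- \<alpha>) = \<theta> * (\<mu> + \<delta>)"
    using \<alpha> \<theta> \<mu> \<delta> by (simp_all add: a_def b_def powr_powr)
  \<comment> \<open>Absorbs the factor \<open>2 powr \<alpha>\<close> lost in
    \<open>interferers_path_loss_le\<close>.\<close>
  define \<delta>' where "\<delta>' = \<delta> / 2 powr \<alpha>"
  have \<delta>': "\<delta>' > 0" "2 powr \<alpha> * \<delta>' = \<delta>" using \<delta> by (simp_all add: \<delta>'_def)
  have "0 < prob {\<omega> \<in> space M. (\<lambda>n. Y n \<omega>) \<in> remote_stations \<alpha> (2 * b) \<delta>' \<and> a < norm (U 0 \<omega>) \<and> norm (U 0 \<omega>) < b}"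
    by (rule origin_mobile_in_annulus[OF \<alpha> \<delta>'(1) ab])
  also have "\<dots> \<le> prob {\<omega> \<in> space M. - s < excess \<alpha> \<theta> K (\<lambda>n. U n \<omega>) \<and> excess \<alpha> \<theta> K (\<lambda>n. U n \<omega>) \<le> - \<mu>}"
  proof (rule finite_measure_mono_AE)
    show "AE \<omega> in M. \<omega> \<in> {\<omega> \<in> space M. (\<lambda>n. Y n \<omega>) \<in> remote_stations \<alpha> (2 * b) \<delta>' \<and> a < norm (U 0 \<omega>) \<and> norm (U 0 \<omega>) < b} \<longrightarrow>
        \<omega> \<in> {\<omega> \<in> space M. - s < excess \<alpha> \<theta> K (\<lambda>n. U n \<omega>) \<and> excess \<alpha> \<theta> K (\<lambda>n. U n \<omega>) \<le> - \<mu>}"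
      using station_sample mobile_norm_ge
    proof (eventually_elim, safe)
      fix \<omega> assume Y: "Y 0 \<omega> = 0" "inj (\<lambda>n. Y n \<omega>)" and le: "\<forall>n. norm (Y n \<omega>) \<le> 2 * norm (U n \<omega>)"
        and remote: "(\<lambda>n. Y n \<omega>) \<in> remote_stations \<alpha> (2 * b) \<delta>'"
        and U0: "a < norm (U 0 \<omega>)" "norm (U 0 \<omega>) < b"
      let ?u = "\<lambda>n. U n \<omega>"
      let ?T = "\<Sum>n. ennreal (norm (?u n) powr (- \<alpha>)) * indicator (- ({0} \<union> cancelled K ?u)) n"
      have "?T \<le> ennreal (2 powr \<alpha>) * path_loss \<alpha> (\<lambda>n. Y n \<omega>)"
        using \<alpha> by (intro interferers_path_loss_le Y le) simp
      also have "\<dots> < ennreal (2 powr \<alpha>) * ennreal \<delta>'"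
        using remote by (intro ennreal_mult_strict_left_mono) (auto simp: remote_stations_def)
      also have "\<dots> = ennreal \<delta>" using \<delta>' by (simp add: ennreal_mult'[symmetric])
      finally have T: "?T < ennreal \<delta>" .
      then have "enn2real ?T < \<delta>" using \<delta>(1) by (cases ?T) (auto simp: ennreal_less_iff)
      then have I: "interference \<alpha> 1 K ?u < \<delta>" "0 \<le> interference \<alpha> 1 K ?u"
        using infsum_eq_enn2real_suminf[of "\<lambda>n. norm (?u n) powr (- \<alpha>)" "- ({0} \<union> cancelled K ?u)"]
        by (simp_all add: interference_def infsum_nonneg)
      have "norm (U 0 \<omega>) powr (- \<alpha>) < a powr (- \<alpha>)" "b powr (- \<alpha>) < norm (U 0 \<omega>) powr (- \<alpha>)"
        using U0 ab \<alpha> by (auto intro!: powr_less_mono2_neg)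
      then have "inverse \<theta> * norm (U 0 \<omega>) powr (- \<alpha>) < \<mu> + 2 * \<delta>" "\<mu> + \<delta> < inverse \<theta> * norm (U 0 \<omega>) powr (- \<alpha>)"
        unfolding a' b' using \<theta> by (simp_all add: field_simps)
      then show "- s < excess \<alpha> \<theta> K ?u" "excess \<alpha> \<theta> K ?u \<le> - \<mu>"
        using I \<delta> unfolding excess_def by linarith+
    qed
    note [measurable] = excess_random_variable
    show "{\<omega> \<in> space M. - s < excess \<alpha> \<theta> K (\<lambda>n. U n \<omega>) \<and> excess \<alpha> \<theta> K (\<lambda>n. U n \<omega>) \<le> - \<mu>} \<in> sets M"
      by measurable
  qed
  finally show ?thesis .
qed

lemma outage_prob_excess:
  assumes "q > 0" "\<theta> > 0" "\<sigma>\<^sup>2 > 0"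
  shows "outage_prob M U \<alpha> \<theta> \<sigma> K q = prob {\<omega> \<in> space M. excess \<alpha> \<theta> K (\<lambda>n. U n \<omega>) + \<sigma>\<^sup>2 / q > 0}"
  unfolding outage_prob_def using outage_iff_excess[OF assms, of "\<lambda>n. U n _"] by simp

text \<open>Monotonicity gives one direction. For the other, if s > \<mu> the two events differ by
  the event that the excess lies in (- s, - \<mu>], whose probability is positive; continuity of the
  law is not at issue.\<close>

lemma excess_tail_le_iff:
  assumes \<alpha>: "\<alpha> > 2" and \<theta>: "\<theta> > 0" and \<mu>: "0 < \<mu>"
  shows "prob {\<omega> \<in> space M. excess \<alpha> \<theta> K (\<lambda>n. U n \<omega>) + s > 0} \<le>
    prob {\<omega> \<in> space M. excess \<alpha> \<theta> K (\<lambda>n. U n \<omega>) + \<mu> > 0} \<longleftrightarrow> s \<le> \<mu>"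
proof
  let ?X = "\<lambda>\<omega>. excess \<alpha> \<theta> K (\<lambda>n. U n \<omega>)"
  note [measurable] = excess_random_variable
  show "prob {\<omega> \<in> space M. ?X \<omega> + s > 0} \<le> prob {\<omega> \<in> space M. ?X \<omega> + \<mu> > 0}" if "s \<le> \<mu>"
  proof (rule finite_measure_mono)
    show "{\<omega> \<in> space M. ?X \<omega> + s > 0} \<subseteq> {\<omega> \<in> space M. ?X \<omega> + \<mu> > 0}" using that by auto
  qed measurable
  assume le: "prob {\<omega> \<in> space M. ?X \<omega> + s > 0} \<le> prob {\<omega> \<in> space M. ?X \<omega> + \<mu> > 0}"
  show "s \<le> \<mu>"
  proof (rule ccontr)
    assume "\<not> s \<le> \<mu>"
    then have s: "\<mu> < s" by simp
    have eq: "{\<omega> \<in> space M. ?X \<omega> + s > 0} =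
        {\<omega> \<in> space M. ?X \<omega> + \<mu> > 0} \<union> {\<omega> \<in> space M. - s < ?X \<omega> \<and> ?X \<omega> \<le> - \<mu>}"
      using s by auto
    have "prob {\<omega> \<in> space M. ?X \<omega> + s > 0} =
        prob {\<omega> \<in> space M. ?X \<omega> + \<mu> > 0} + prob {\<omega> \<in> space M. - s < ?X \<omega> \<and> ?X \<omega> \<le> - \<mu>}"
      unfolding eq by (intro finite_measure_Union) (measurable, auto)
    then show False using le excess_charges_intervals[OF \<alpha> \<theta> \<mu> s, of K] by linarith
  qed
qed

lemma infsum_AE_eq_excess:
  assumes "\<alpha> > 2"
  shows "AE \<omega> in M. (\<Sum>\<^sub>\<infinity>n. norm (U n \<omega>) powr (- \<alpha>) * of_bool (n \<notin> {0} \<union> cancelled K (\<lambda>m. U m \<omega>))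
      - inverse \<theta> * norm (U 0 \<omega>) powr (- \<alpha>) * of_bool (n = 0)) = excess \<alpha> \<theta> K (\<lambda>n. U n \<omega>)"
  using station_sample mobile_norm_ge path_loss_finite[OF assms]
proof eventually_elim
  case (elim \<omega>)
  have "(\<Sum>n. ennreal (norm (U n \<omega>) powr (- \<alpha>)) * indicator (- ({0} \<union> cancelled K (\<lambda>n. U n \<omega>))) n) \<le>
      ennreal (2 powr \<alpha>) * path_loss \<alpha> (\<lambda>n. Y n \<omega>)"
    using elim assms by (intro interferers_path_loss_le) auto
  also have "\<dots> < \<infinity>" using elim by (simp add: ennreal_mult_less_top)
  finally show ?case by (rule infsum_eq_excess)
qed

end

theorem proposition1:
  fixes M :: "real \<Rightarrow> 'w measure"
    and Y U :: "real \<Rightarrow> nat \<Rightarrow> 'w \<Rightarrow> real ^ 2"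
    and \<alpha> \<theta> \<sigma> \<epsilon> \<mu> :: real
    and K :: nat
  assumes "\<alpha> > 2" and "\<theta> > 0" and "\<sigma>\<^sup>2 > 0" and "0 < \<epsilon>" and "\<epsilon> < 1"
    and network: "\<And>lam. lam > 0 \<Longrightarrow> cellular_uplink (M lam) lam (Y lam) (U lam)"
    and "\<mu> > 0"
    and \<mu>_eq: "measure (M 1) {\<omega> \<in> space (M 1).
        (\<Sum>\<^sub>\<infinity>n. norm (U 1 n \<omega>) powr (- \<alpha>) * of_bool (n \<notin> {0} \<union> cancelled K (\<lambda>m. U 1 m \<omega>))
              - inverse \<theta> * norm (U 1 0 \<omega>) powr (- \<alpha>) * of_bool (n = 0)) + \<mu> > 0} = \<epsilon>"
  shows "{(lam_b, p). lam_b > 0 \<and> p > 0 \<and> outage_prob (M lam_b) (U lam_b) \<alpha> \<theta> \<sigma> K p \<le> \<epsilon>} =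
         {(lam_b, p). lam_b \<ge> 0 \<and> p \<ge> 0 \<and> p * lam_b powr (\<alpha> / 2) \<ge> \<sigma>\<^sup>2 / \<mu>}"
proof -
  interpret N: cellular_uplink "M 1" 1 "Y 1" "U 1" by (rule network) simp
  let ?X = "\<lambda>\<omega>. excess \<alpha> \<theta> K (\<lambda>n. U 1 n \<omega>)"
  note [measurable] = N.excess_random_variable
  have "\<epsilon> = N.prob {\<omega> \<in> space (M 1). ?X \<omega> + \<mu> > 0}"
    unfolding \<mu>_eq[symmetric]
  proof (rule N.finite_measure_eq_AE)
    \<comment> \<open>Measurability follows from \<open>\<mu>_eq\<close>: a set outside the
      sigma-algebra has measure 0 by default, while \<epsilon> > 0.\<close>
    show "{\<omega> \<in> space (M 1).
        (\<Sum>\<^sub>\<infinity>n. norm (U 1 n \<omega>) powr (- \<alpha>) * of_bool (n \<notin> {0} \<union> cancelled K (\<lambda>m. U 1 m \<omega>))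
              - inverse \<theta> * norm (U 1 0 \<omega>) powr (- \<alpha>) * of_bool (n = 0)) + \<mu> > 0} \<in> N.events"
      using \<mu>_eq \<open>0 < \<epsilon>\<close> measure_notin_sets by fastforce
  qed (use N.infsum_AE_eq_excess[OF \<open>\<alpha> > 2\<close>, of K \<theta>] in \<open>measurable, auto\<close>)
  then have outage: "outage_prob (M lam) (U lam) \<alpha> \<theta> \<sigma> K p \<le> \<epsilon> \<longleftrightarrow> p * lam powr (\<alpha> / 2) \<ge> \<sigma>\<^sup>2 / \<mu>"
    if "lam > 0" "p > 0" for lam p
  proof -
    define q where "q = p * lam powr (\<alpha> / 2)"
    have q: "q > 0" using that by (simp add: q_def)
    have "outage_prob (M lam) (U lam) \<alpha> \<theta> \<sigma> K p = outage_prob (M 1) (U 1) \<alpha> \<theta> \<sigma> K q"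
      unfolding q_def by (rule outage_prob_density[OF network[OF that(1)] N.cellular_uplink_axioms])
    also have "\<dots> = N.prob {\<omega> \<in> space (M 1). ?X \<omega> + \<sigma>\<^sup>2 / q > 0}"
      by (rule N.outage_prob_excess[OF q assms(2,3)])
    finally have "outage_prob (M lam) (U lam) \<alpha> \<theta> \<sigma> K p \<le> \<epsilon> \<longleftrightarrow> \<sigma>\<^sup>2 / q \<le> \<mu>"
      using N.excess_tail_le_iff[OF assms(1,2,7), of K "\<sigma>\<^sup>2 / q"] \<open>\<epsilon> = _\<close> by simp
    also have "\<dots> \<longleftrightarrow> q \<ge> \<sigma>\<^sup>2 / \<mu>" using q assms(7) by (simp add: field_simps)
    finally show ?thesis by (simp add: q_def)
  qed
  have pos: "\<sigma>\<^sup>2 / \<mu> > 0" using assms by simp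
  \<comment> \<open>The right-hand set admits zeros, but there the product is 0, in particular
    because \<open>0 powr (\<alpha> / 2) = 0\<close>, and so lies below the positive
    threshold.\<close>
  have "lam > 0 \<and> p > 0" if "lam \<ge> 0" "p \<ge> 0" "p * lam powr (\<alpha> / 2) \<ge> \<sigma>\<^sup>2 / \<mu>" for lam p :: real
    using that pos by (cases "lam = 0"; cases "p = 0") auto
  then show ?thesis using outage by fastforce
qed

end
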